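(* For every set superpartition $I$ of bidegree $(n,m)$, we have $$m_I=\sum_{K\sqsupseteq I}\mu(I,K)\,p_K,$$ $$m_I=\sum_{L\sqsupseteq I}\frac{\mu(I,L)}{\mu(\hat 0_{n,m},L)}\sum_{K\sqsubseteq L}\mu(K,L)\,e_K,$$ $$m_I=\sum_{L\sqsupseteq I}\frac{\mu(I,L)}{|\mu(\hat 0_{n,m},L)|}\sum_{K\sqsubseteq L}\mu(K,L)\,h_K,$$ where $K,L$ range over partial set supercompositions of bidegree $(n,m)$.
   Context: Combinatorial objects. $[n]=\{1,\dots,n\}$, $[n]_0=[n]\cup\{0\}$, and $A^+=A\setminus\{0\}$. For $0\le m\le n+1$, a partial set supercomposition of bidegree $(n,m)$ (degree $n$, fermionic degree $m$) is a tuple $K=(K_1,\dots,K_q)$ of nonempty subsets of $[n]_0$ (blocks) such that $K_1^+\cup\dots\cup K_q^+=[n]$, $K_i\cap K_j\subseteq\{0\}$ for $i\ne j$, $0\in K_i$ exactly for $i\le m$ (these are the fermionic blocks), and the nonfermionic blocks $K_{m+1},\dots,K_q$ are ordered by increasing minimum. $s\mathcal C_{n,m}$ is the set of these. A set superpartition is a partial set supercomposition $I=(I_1,\dots,I_k)$ with $I_i\ne I_j$ and $\min(I_i\setminus I_j)<\min(I_j\setminus I_i)$ for all $i<j$, where $\min(\emptyset):=0$. For $K,L\in s\mathcal C_{n,m}$ write $K\sqsubseteq L$ (equivalently $L\sqsupseteq K$) if, for every $i\in[m]$, the $i$th fermionic block of $L$ is the union of the $i$th fermionic block of $K$ with some (possibly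 no) nonfermionic blocks of $K$, and each nonfermionic block of $L$ is a union of nonfermionic blocks of $K$. This is a partial order making $s\mathcal C_{n,m}$ a meet-semilattice, with meet denoted $\sqcap$ and least element $\hat 0_{n,m}=(\{0\},\dots,\{0\},\{1\},\dots,\{n\})$ ($m$ copies of $\{0\}$). $\mu$ is the Möbius function of the poset $(s\mathcal C_{n,m},\sqsubseteq)$: $\mu(K,K)=1$ and $\mu(K,L)=-\sum_{K\sqsubseteq N\sqsubset L}\mu(K,N)$ if $K\sqsubset L$. For a tuple of sets $N=(N_1,\dots,N_r)$, $N!=|N_1|!\cdots|N_r|!$ (the element $0$ is counted in the cardinalities). Functions. Let $\mathcal A$ be the $\mathbb Q$-algebra of formal power series of bounded degree in variables $x_1,x_2,\dots$ and $\theta_1,\theta_2,\dots$ subject only to $x_i\theta_j=\theta_jx_i$ and $\theta_i\theta_j=-\theta_j\theta_i$ for all $i,j$ (so $\theta_i^2=0$ and the $x_i$ do not commute with each other). For $K\in s\mathcal C_{n,m}$, each function below is a sum in $\mathcal A$ over words $\theta_{a_1}\cdots\theta_{a_m}x_{b_1}\cdots x_{b_n}$ with positive integer indices: - $m_K$ is the sum of all words in $M(K)$, the set of words with, for $i\in[m]$, $a_i=b_j$ iff $j\in K_i^+$, and, for $i,j\in[n]$, $b_i=b_j$ iff $i,j$ lie in the same block of $K$. - $p_K$ is the sum of all words such that $a_i=b_j$ whenever $i\in[m]$, $j\in K_i^+$, and $b_i=b_j$ whenever $i,j\in[n]$ lie in the same block of $K$. - $e_K$ is the sum of all words such that $a_i\ne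 b_j$ whenever $i\in[m]$, $j\in K_i^+$, and $b_i\neq b_j$ whenever $i\ne j$ in $[n]$ lie in the same block of $K$. - $h_K=\sum_u c_u\,u$, over all words $u$ with $a_1,\dots,a_m$ pairwise distinct and such that $\{a_1,\dots,a_m\}\setminus\{b_1,\dots,b_n\}$ has at most one element, where $c_u=(K\sqcap L)!$ and $L$ is the unique element of $s\mathcal C_{n,m}$ with $u\in M(L)$. *)

theory Defs
  imports Complex_Main
begin

section \<open>Superspace in noncommuting variables\<close>

text \<open>
  The monomials \<open>\<theta>\<^sub>s\<^sub>1 \<dots> \<theta>\<^sub>s\<^sub>r x\<^sub>w\<^sub>1 \<dots> x\<^sub>w\<^sub>k\<close> with \<open>s\<^sub>1 < \<dots> < s\<^sub>r\<close> form a topological basis of the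
  algebra of formal power series of bounded degree.  Such a monomial is encoded by the finite
  set \<open>S = {s\<^sub>1, \<dots>, s\<^sub>r}\<close> and the list \<open>w\<close>, and a series is given by its coefficients.  All indices
  are positive (so \<open>var_x 0 = var_theta 0 = 0\<close> below are junk values).  Multiplying the \<open>\<theta>\<close>-parts of \<open>S\<close> and \<open>T\<close> (disjoint) yields the sign
  \<open>(-1) ^ inv_count S T\<close>.
\<close>

definition inv_count :: "nat set \<Rightarrow> nat set \<Rightarrow> nat" where
  "inv_count S T = card {(s, t). s \<in> S \<and> t \<in> T \<and> t < s}"

typedef sseries =
  "{f :: nat set \<Rightarrow> nat list \<Rightarrow> rat.
     \<exists>d. \<forall>S w. f S w \<noteq> 0 \<longrightarrow> finite S \<and> 0 \<notin> S \<and> 0 \<notin> set w \<and> card S + length w \<le> d}"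
  morphisms coeff Abs_sseries
  by (rule exI[of _ "\<lambda>_ _. 0"]) simp

setup_lifting type_definition_sseries

lemma sseries_eqI: "(\<And>S w. coeff f S w = coeff g S w) \<Longrightarrow> f = g"
  by (simp add: coeff_inject[symmetric] fun_eq_iff)

lemma coeff_nonzero:
  assumes "coeff f S w \<noteq> 0"
  shows "finite S" "0 \<notin> S" "0 \<notin> set w"
  using coeff[of f] assms by auto

instantiation sseries :: ring_1
begin

lift_definition zero_sseries :: sseries is "\<lambda>S w. 0" by simp

lift_definition one_sseries :: sseries is "\<lambda>S w. if S = {} \<and> w = [] then 1 else 0"
  by (rule exI[of _ 0]) auto

lift_definition plus_sseries :: "sseries \<Rightarrow> sseries \<Rightarrow> sseries" is "\<lambda>f g S w. f S w + g S w"
proof -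
  fix f g :: "nat set \<Rightarrow> nat list \<Rightarrow> rat"
  assume "\<exists>d. \<forall>S w. f S w \<noteq> 0 \<longrightarrow> finite S \<and> 0 \<notin> S \<and> 0 \<notin> set w \<and> card S + length w \<le> d"
    and "\<exists>d. \<forall>S w. g S w \<noteq> 0 \<longrightarrow> finite S \<and> 0 \<notin> S \<and> 0 \<notin> set w \<and> card S + length w \<le> d"
  then obtain d e where
    d: "\<And>S w. f S w \<noteq> 0 \<Longrightarrow> finite S \<and> 0 \<notin> S \<and> 0 \<notin> set w \<and> card S + length w \<le> d" and
    e: "\<And>S w. g S w \<noteq> 0 \<Longrightarrow> finite S \<and> 0 \<notin> S \<and> 0 \<notin> set w \<and> card S + length w \<le> e" by blast
  show "\<exists>d. \<forall>S w. f S w + g S w \<noteq> 0 \<longrightarrow>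
      finite S \<and> 0 \<notin> S \<and> 0 \<notin> set w \<and> card S + length w \<le> d"
  proof (intro exI[of _ "max d e"] allI impI)
    fix S w assume "f S w + g S w \<noteq> 0"
    then have "f S w \<noteq> 0 \<or> g S w \<noteq> 0" by auto
    then show "finite S \<and> 0 \<notin> S \<and> 0 \<notin> set w \<and> card S + length w \<le> max d e"
      using d[of S w] e[of S w] by auto
  qed
qed

lift_definition uminus_sseries :: "sseries \<Rightarrow> sseries" is "\<lambda>f S w. - f S w" by simp

definition minus_sseries :: "sseries \<Rightarrow> sseries \<Rightarrow> sseries" where
  "minus_sseries f g = f + - g"

lift_definition times_sseries :: "sseries \<Rightarrow> sseries \<Rightarrow> sseries" is
  "\<lambda>f g S w. \<Sum>T\<in>Pow S. \<Sum>k\<le>length w.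
     (-1) ^ inv_count T (S - T) * f T (take k w) * g (S - T) (drop k w)"
proof -
  fix f g :: "nat set \<Rightarrow> nat list \<Rightarrow> rat"
  assume "\<exists>d. \<forall>S w. f S w \<noteq> 0 \<longrightarrow> finite S \<and> 0 \<notin> S \<and> 0 \<notin> set w \<and> card S + length w \<le> d"
    and "\<exists>d. \<forall>S w. g S w \<noteq> 0 \<longrightarrow> finite S \<and> 0 \<notin> S \<and> 0 \<notin> set w \<and> card S + length w \<le> d"
  then obtain d e where
    d: "\<And>S w. f S w \<noteq> 0 \<Longrightarrow> finite S \<and> 0 \<notin> S \<and> 0 \<notin> set w \<and> card S + length w \<le> d" and
    e: "\<And>S w. g S w \<noteq> 0 \<Longrightarrow> finite S \<and> 0 \<notin> S \<and> 0 \<notin> set w \<and> card S + length w \<le> e" by blast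
  show "\<exists>d. \<forall>S w. (\<Sum>T\<in>Pow S. \<Sum>k\<le>length w.
      (-1) ^ inv_count T (S - T) * f T (take k w) * g (S - T) (drop k w)) \<noteq> 0 \<longrightarrow>
      finite S \<and> 0 \<notin> S \<and> 0 \<notin> set w \<and> card S + length w \<le> d"
  proof (intro exI[of _ "d + e"] allI impI)
    fix S w
    assume "(\<Sum>T\<in>Pow S. \<Sum>k\<le>length w.
      (-1) ^ inv_count T (S - T) * f T (take k w) * g (S - T) (drop k w)) \<noteq> 0"
    then obtain T where T: "T \<in> Pow S" and
      "(\<Sum>k\<le>length w. (-1) ^ inv_count T (S - T) * f T (take k w) * g (S - T) (drop k w)) \<noteq> 0"
      by (meson sum.neutral)
    then obtain k where "k \<le> length w" and
      nz: "(-1) ^ inv_count T (S - T) * f T (take k w) * g (S - T) (drop k w) \<noteq> 0"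
      by (meson sum.neutral atMost_iff)
    have 1: "f T (take k w) \<noteq> 0" "g (S - T) (drop k w) \<noteq> 0" using nz by auto
    note df = d[OF 1(1)] and eg = e[OF 1(2)]
    have S: "S = T \<union> (S - T)" using T by auto
    have "card S = card T + card (S - T)"
      using df eg by (subst S, subst card_Un_disjoint) auto
    moreover have "length w = length (take k w) + length (drop k w)"
      by (metis append_take_drop_id length_append)
    moreover have "set w = set (take k w) \<union> set (drop k w)"
      by (metis append_take_drop_id set_append)
    moreover have "finite S" using df eg S by (metis finite_UnI)
    moreover have "0 \<notin> S" using df eg S by auto
    ultimately show "finite S \<and> 0 \<notin> S \<and> 0 \<notin> set w \<and> card S + length w \<le> d + e"
      using df eg by auto
  qed
qed

lemma inv_count_Un:
  assumes "finite A" "finite B" "finite C" "A \<inter> B = {}"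
  shows "inv_count (A \<union> B) C = inv_count A C + inv_count B C"
    and "inv_count C (A \<union> B) = inv_count C A + inv_count C B"
proof -
  have fin: "finite {(s, t). s \<in> X \<and> t \<in> Y \<and> t < s}" if "finite X" "finite Y" for X Y :: "nat set"
    by (rule finite_subset[of _ "X \<times> Y"]) (use that in auto)
  have "{(s, t). s \<in> A \<union> B \<and> t \<in> C \<and> t < s} =
      {(s, t). s \<in> A \<and> t \<in> C \<and> t < s} \<union> {(s, t). s \<in> B \<and> t \<in> C \<and> t < s}" by auto
  then show "inv_count (A \<union> B) C = inv_count A C + inv_count B C"
    unfolding inv_count_def using assms by (subst card_Un_disjoint[symmetric]) (auto intro!: fin)
  have "{(s, t). s \<in> C \<and> t \<in> A \<union> B \<and> t < s} =
      {(s, t). s \<in> C \<and> t \<in> A \<and> t < s} \<union> {(s, t). s \<in> C \<and> t \<in> B \<and> t < s}" by auto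
  then show "inv_count C (A \<union> B) = inv_count C A + inv_count C B"
    unfolding inv_count_def using assms by (subst card_Un_disjoint[symmetric]) (auto intro!: fin)
qed

lemma inv_count_empty: "inv_count {} T = 0" "inv_count S {} = 0"
  by (simp_all add: inv_count_def)

lemma sum_Pow_assoc:
  fixes F :: "'b set \<Rightarrow> 'b set \<Rightarrow> 'b set \<Rightarrow> rat"
  assumes "finite S"
  shows "(\<Sum>T\<in>Pow S. \<Sum>A\<in>Pow T. F A (T - A) (S - T)) =
         (\<Sum>A\<in>Pow S. \<Sum>B\<in>Pow (S - A). F A B (S - A - B))"
proof -
  have "(\<Sum>T\<in>Pow S. \<Sum>A\<in>Pow T. F A (T - A) (S - T)) =
      (\<Sum>(T, A)\<in>(SIGMA T:Pow S. Pow T). F A (T - A) (S - T))"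
    using assms by (intro sum.Sigma) (auto intro: finite_subset)
  also have "\<dots> = (\<Sum>(A, B)\<in>(SIGMA A:Pow S. Pow (S - A)). F A B (S - A - B))"
    by (rule sum.reindex_bij_witness[where i = "\<lambda>(A, B). (A \<union> B, A)" and j = "\<lambda>(T, A). (A, T - A)"])
       (auto intro!: arg_cong2[where f = "F _"])
  also have "\<dots> = (\<Sum>A\<in>Pow S. \<Sum>B\<in>Pow (S - A). F A B (S - A - B))"
    using assms by (intro sum.Sigma[symmetric]) auto
  finally show ?thesis .
qed

lemma sum_split_assoc:
  fixes F :: "'b list \<Rightarrow> 'b list \<Rightarrow> 'b list \<Rightarrow> rat"
  shows "(\<Sum>k\<le>length w. \<Sum>j\<le>length (take k w). F (take j (take k w)) (drop j (take k w)) (drop k w)) =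
         (\<Sum>j\<le>length w. \<Sum>i\<le>length (drop j w). F (take j w) (take i (drop j w)) (drop i (drop j w)))"
proof -
  have "(\<Sum>k\<le>length w. \<Sum>j\<le>length (take k w). F (take j (take k w)) (drop j (take k w)) (drop k w)) =
      (\<Sum>(k, j)\<in>(SIGMA k:{..length w}. {..length (take k w)}).
         F (take j (take k w)) (drop j (take k w)) (drop k w))"
    by (intro sum.Sigma) auto
  also have "\<dots> = (\<Sum>(j, i)\<in>(SIGMA j:{..length w}. {..length (drop j w)}).
      F (take j w) (take i (drop j w)) (drop i (drop j w)))"
    by (rule sum.reindex_bij_witness[where i = "\<lambda>(j, i). (i + j, j)" and j = "\<lambda>(k, j). (j, k - j)"])
       (auto simp: drop_take min_absorb2)
  also have "\<dots> = (\<Sum>j\<le>length w. \<Sum>i\<le>length (drop j w).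
      F (take j w) (take i (drop j w)) (drop i (drop j w)))"
    by (intro sum.Sigma[symmetric]) auto
  finally show ?thesis .
qed

lemma coeff_times_infinite: "infinite S \<Longrightarrow> coeff (f * g) S w = 0"
  using coeff_nonzero(1) by blast

instance
proof
  fix a b c :: sseries
  show "a + b + c = a + (b + c)" by transfer (simp add: fun_eq_iff)
  show "a + b = b + a" by transfer (simp add: fun_eq_iff)
  show "0 + a = a" by transfer simp
  show "- a + a = 0" by transfer simp
  show "a - b = a + - b" by (simp add: minus_sseries_def)
  show "(a + b) * c = a * c + b * c"
    by transfer (simp add: fun_eq_iff sum.distrib[symmetric] algebra_simps)
  show "a * (b + c) = a * b + a * c"
    by transfer (simp add: fun_eq_iff sum.distrib[symmetric] algebra_simps)
  show "(0 :: sseries) \<noteq> 1"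
    by (rule notI, drule arg_cong[of _ _ "\<lambda>f. coeff f {} []"])
       (simp add: zero_sseries.rep_eq one_sseries.rep_eq)
  show "1 * a = a"
  proof (rule sseries_eqI)
    fix S w
    show "coeff (1 * a) S w = coeff a S w"
    proof (cases "finite S")
      case True
      have "coeff (1 * a) S w = (\<Sum>T\<in>Pow S. \<Sum>k\<le>length w.
          if k = 0 then if T = {} then coeff a S w else 0 else 0)"
        by (simp only: times_sseries.rep_eq, intro sum.cong refl)
           (auto simp: one_sseries.rep_eq inv_count_empty)
      also have "\<dots> = coeff a S w"
        using True by simp
      finally show ?thesis .
    qed (metis coeff_nonzero(1))
  qed
  show "a * 1 = a"
  proof (rule sseries_eqI)
    fix S w
    show "coeff (a * 1) S w = coeff a S w"
    proof (cases "finite S")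
      case True
      have "coeff (a * 1) S w = (\<Sum>T\<in>Pow S. \<Sum>k\<le>length w.
          if k = length w then if T = S then coeff a S w else 0 else 0)"
        by (simp only: times_sseries.rep_eq, intro sum.cong refl)
           (auto simp: one_sseries.rep_eq inv_count_empty)
      also have "\<dots> = coeff a S w"
        using True by simp
      finally show ?thesis .
    qed (metis coeff_nonzero(1))
  qed
  show "a * b * c = a * (b * c)"
  proof (rule sseries_eqI)
    fix S w
    show "coeff (a * b * c) S w = coeff (a * (b * c)) S w"
    proof (cases "finite S")
      case True
      define G where "G A B C u v z =
        (-1 :: rat) ^ (inv_count A B + inv_count A C + inv_count B C) *
        coeff a A u * coeff b B v * coeff c C z" for A B C u v z
      have "coeff (a * b * c) S w = (\<Sum>T\<in>Pow S. \<Sum>k\<le>length w. \<Sum>A\<in>Pow T. \<Sum>j\<le>length (take k w).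
          G A (T - A) (S - T) (take j (take k w)) (drop j (take k w)) (drop k w))"
        unfolding times_sseries.rep_eq sum_distrib_left sum_distrib_right
      proof (intro sum.cong refl, goal_cases)
        case (1 T k A j)
        have "inv_count T (S - T) = inv_count (A \<union> (T - A)) (S - T)"
          using 1 by (intro arg_cong2[where f = inv_count]) auto
        also have "\<dots> = inv_count A (S - T) + inv_count (T - A) (S - T)"
          using 1 True by (intro inv_count_Un) (auto intro: finite_subset)
        finally show ?case by (simp add: G_def power_add algebra_simps)
      qed
      also have "\<dots> = (\<Sum>T\<in>Pow S. \<Sum>A\<in>Pow T. \<Sum>k\<le>length w. \<Sum>j\<le>length (take k w).
          G A (T - A) (S - T) (take j (take k w)) (drop j (take k w)) (drop k w))"
        by (intro sum.cong refl sum.swap)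
      also have "\<dots> = (\<Sum>A\<in>Pow S. \<Sum>B\<in>Pow (S - A). \<Sum>k\<le>length w. \<Sum>j\<le>length (take k w).
          G A B (S - A - B) (take j (take k w)) (drop j (take k w)) (drop k w))"
        by (rule sum_Pow_assoc[OF True])
      also have "\<dots> = (\<Sum>A\<in>Pow S. \<Sum>B\<in>Pow (S - A). \<Sum>j\<le>length w. \<Sum>i\<le>length (drop j w).
          G A B (S - A - B) (take j w) (take i (drop j w)) (drop i (drop j w)))"
        by (intro sum.cong refl sum_split_assoc)
      also have "\<dots> = (\<Sum>A\<in>Pow S. \<Sum>j\<le>length w. \<Sum>B\<in>Pow (S - A). \<Sum>i\<le>length (drop j w).
          G A B (S - A - B) (take j w) (take i (drop j w)) (drop i (drop j w)))"
        by (intro sum.cong refl sum.swap)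
      also have "\<dots> = coeff (a * (b * c)) S w"
        unfolding times_sseries.rep_eq sum_distrib_left sum_distrib_right
      proof (intro sum.cong refl, goal_cases)
        case (1 A j B i)
        have "inv_count A (S - A) = inv_count A (B \<union> (S - A - B))"
          using 1 by (intro arg_cong2[where f = inv_count]) auto
        also have "\<dots> = inv_count A B + inv_count A (S - A - B)"
          using 1 True by (intro inv_count_Un) (auto intro: finite_subset)
        finally show ?case by (simp add: G_def power_add algebra_simps)
      qed
      finally show ?thesis .
    qed (simp add: coeff_times_infinite)
  qed
qed

end

lift_definition scaleQ :: "rat \<Rightarrow> sseries \<Rightarrow> sseries" is "\<lambda>c f S w. c * f S w"
proof -
  fix c :: rat and f :: "nat set \<Rightarrow> nat list \<Rightarrow> rat"
  assume "\<exists>d. \<forall>S w. f S w \<noteq> 0 \<longrightarrow> finite S \<and> 0 \<notin> S \<and> 0 \<notin> set w \<and> card S + length w \<le> d"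
  then show "\<exists>d. \<forall>S w. c * f S w \<noteq> 0 \<longrightarrow>
      finite S \<and> 0 \<notin> S \<and> 0 \<notin> set w \<and> card S + length w \<le> d"
    by (metis mult_zero_right)
qed

lemma vector_space_scaleQ: "vector_space scaleQ"
  by unfold_locales
     (auto intro!: sseries_eqI simp: scaleQ.rep_eq plus_sseries.rep_eq algebra_simps)

lemma scaleQ_times: "scaleQ c f * g = scaleQ c (f * g)" "f * scaleQ c g = scaleQ c (f * g)"
  by (auto intro!: sseries_eqI sum.cong
        simp: scaleQ.rep_eq times_sseries.rep_eq sum_distrib_left)

lift_definition var_x :: "nat \<Rightarrow> sseries" is
  "\<lambda>i S w. if i > 0 \<and> S = {} \<and> w = [i] then 1 else 0"
  by (intro exI[of _ 1]) auto

lift_definition var_theta :: "nat \<Rightarrow> sseries" is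
  "\<lambda>i S w. if i > 0 \<and> S = {i} \<and> w = [] then 1 else 0"
  by (intro exI[of _ 1]) auto

lemma coeff_var_x_times:
  "coeff (var_x i * f) S w = (if i > 0 \<and> w \<noteq> [] \<and> hd w = i then coeff f S (tl w) else 0)"
proof (cases "finite S")
  case True
  have "coeff (var_x i * f) S w = (\<Sum>T\<in>Pow S. \<Sum>k\<le>length w.
      if k = 1 then if T = {} then if i > 0 \<and> w \<noteq> [] \<and> hd w = i then coeff f S (tl w) else 0
      else 0 else 0)"
    unfolding times_sseries.rep_eq
  proof (intro sum.cong refl, goal_cases)
    case (1 T k)
    show ?case
    proof (cases "\<exists>v w'. w = v # w' \<and> k = 1")
      case True
      then show ?thesis by (auto simp: var_x.rep_eq inv_count_empty)
    next
      case False
      then have "take k w \<noteq> [i]" and "k = 1 \<Longrightarrow> w = []"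
        using 1 by (cases w; auto simp: take_Cons' split: if_splits)+
      then show ?thesis by (auto simp: var_x.rep_eq)
    qed
  qed
  also have "\<dots> = (if i > 0 \<and> w \<noteq> [] \<and> hd w = i then coeff f S (tl w) else 0)"
    using True by (cases w) (simp_all del: sum.atMost_Suc)
  finally show ?thesis .
qed (use coeff_nonzero(1) in \<open>auto simp: coeff_times_infinite\<close>)

lemma inv_count_singleton: "inv_count {i} T = card {t \<in> T. t < i}"
proof -
  have "{(s, t). s \<in> {i} \<and> t \<in> T \<and> t < s} = Pair i ` {t \<in> T. t < i}" by auto
  then show ?thesis by (simp add: inv_count_def card_image inj_on_def)
qed

lemma coeff_var_theta_times:
  "coeff (var_theta i * f) S w =
     (if i > 0 \<and> i \<in> S then (-1) ^ card {t \<in> S. t < i} * coeff f (S - {i}) w else 0)"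
proof (cases "finite S")
  case True
  have *: "{t. (t \<in> S \<and> t \<noteq> i) \<and> t < i} = {t \<in> S. t < i}"
    "{t \<in> S. t \<noteq> i \<and> t < i} = {t \<in> S. t < i}" by auto
  have "coeff (var_theta i * f) S w = (\<Sum>T\<in>Pow S. \<Sum>k\<le>length w.
      if k = 0 then if T = {i} then if i > 0
        then (-1) ^ card {t \<in> S. t < i} * coeff f (S - {i}) w else 0 else 0 else 0)"
    unfolding times_sseries.rep_eq
    by (intro sum.cong refl) (auto simp: var_theta.rep_eq inv_count_singleton *)
  also have "\<dots> = (if i > 0 \<and> i \<in> S then (-1) ^ card {t \<in> S. t < i} * coeff f (S - {i}) w else 0)"
    using True by simp
  finally show ?thesis .
next
  case False
  then have "infinite (S - {i})" by simp
  then have "coeff f (S - {i}) w = 0" using coeff_nonzero(1) by blast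
  with False show ?thesis by (simp add: coeff_times_infinite)
qed

lemma var_x_var_theta: "var_x i * var_theta j = var_theta j * var_x i"
proof (rule sseries_eqI)
  fix S w
  show "coeff (var_x i * var_theta j) S w = coeff (var_theta j * var_x i) S w"
  proof (cases "S = {j}")
    case True
    then show ?thesis
      by (cases w) (simp_all add: coeff_var_x_times coeff_var_theta_times var_x.rep_eq
        var_theta.rep_eq cong: conj_cong)
  next
    case False
    then have "\<not> (j \<in> S \<and> S - {j} = {})" by auto
    with False show ?thesis
      by (auto simp: coeff_var_x_times coeff_var_theta_times var_x.rep_eq var_theta.rep_eq)
  qed
qed

lemma var_theta_anticomm: "var_theta i * var_theta j = - (var_theta j * var_theta i)"
proof (rule sseries_eqI)
  fix S w
  show "coeff (var_theta i * var_theta j) S w = coeff (- (var_theta j * var_theta i)) S w"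
  proof (cases "i \<noteq> j \<and> S = {i, j}")
    case True
    have "{t \<in> S. t < i} = (if j < i then {j} else {})" "{t \<in> S. t < j} = (if i < j then {i} else {})"
      using True by auto
    moreover have "S - {i} = {j}" "S - {j} = {i}" using True by auto
    ultimately show ?thesis using True
      by (auto simp: coeff_var_theta_times var_theta.rep_eq uminus_sseries.rep_eq)
  next
    case False
    then have "\<not> (S - {i} = {j} \<and> i \<in> S)" "\<not> (S - {j} = {i} \<and> j \<in> S)" by auto
    then show ?thesis
      by (auto simp: coeff_var_theta_times var_theta.rep_eq uminus_sseries.rep_eq)
  qed
qed

type_synonym sword = "nat list \<times> nat list"

definition words :: "nat \<Rightarrow> nat \<Rightarrow> sword set" where
  "words n m = {(a, b). length a = m \<and> length b = n \<and> 0 \<notin> set a \<and> 0 \<notin> set b}"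

definition word_val :: "sword \<Rightarrow> sseries" where
  "word_val u = prod_list (map var_theta (fst u)) * prod_list (map var_x (snd u))"

text \<open>
  The sum in the algebra of a family that may be infinite, formed coefficientwise.  It is used
  only for families of rational multiples of words of one bidegree, for which it makes sense by
  \<open>finite_word_coeff\<close> and \<open>coeff_formal_sum_words\<close> below.
\<close>

definition formal_sum :: "('i \<Rightarrow> sseries) \<Rightarrow> 'i set \<Rightarrow> sseries" where
  "formal_sum f U = Abs_sseries (\<lambda>S w. \<Sum>u\<in>{u \<in> U. coeff (f u) S w \<noteq> 0}. coeff (f u) S w)"

lemma coeff_prod_var_x:
  "coeff (prod_list (map var_x b)) S w = (if S = {} \<and> w = b \<and> 0 \<notin> set b then 1 else 0)"
  by (induction b arbitrary: w)
     (auto simp: one_sseries.rep_eq coeff_var_x_times neq_Nil_conv)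

lemma coeff_word_val_nonzero:
  assumes "coeff (word_val (a, b)) S w \<noteq> 0"
  shows "S = set a" "w = b" "distinct a"
proof -
  have "coeff (word_val (a, b)) S w \<noteq> 0 \<Longrightarrow> S = set a \<and> w = b \<and> distinct a"
  proof (induction a arbitrary: S)
    case Nil
    then show ?case by (auto simp: word_val_def coeff_prod_var_x split: if_splits)
  next
    case (Cons i a)
    have "word_val (i # a, b) = var_theta i * word_val (a, b)"
      by (simp add: word_val_def mult.assoc)
    then have "i \<in> S" "coeff (word_val (a, b)) (S - {i}) w \<noteq> 0"
      using Cons.prems by (auto simp: coeff_var_theta_times split: if_splits)
    with Cons.IH[of "S - {i}"] show ?case by auto
  qed
  with assms show "S = set a" "w = b" "distinct a" by blast+
qed

lemma finite_word_coeff: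
  assumes "U \<subseteq> words n m"
  shows "finite {u \<in> U. coeff (scaleQ (c u) (word_val u)) S w \<noteq> 0}"
proof (cases "finite S")
  case True
  have "{u \<in> U. coeff (scaleQ (c u) (word_val u)) S w \<noteq> 0}
      \<subseteq> {a. set a \<subseteq> S \<and> length a = m} \<times> {w}"
    using assms by (auto simp: words_def scaleQ.rep_eq dest: coeff_word_val_nonzero)
  then show ?thesis
    by (rule finite_subset) (use True in \<open>simp add: finite_lists_length_eq\<close>)
next
  case False
  then have "{u \<in> U. coeff (scaleQ (c u) (word_val u)) S w \<noteq> 0} = {}"
    using coeff_nonzero(1) by blast
  then show ?thesis by (metis finite.emptyI)
qed

lemma coeff_formal_sum_words:
  assumes "U \<subseteq> words n m"
  shows "coeff (formal_sum (\<lambda>u. scaleQ (c u) (word_val u)) U) S w =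
    (\<Sum>u\<in>{u \<in> U. coeff (scaleQ (c u) (word_val u)) S w \<noteq> 0}.
       coeff (scaleQ (c u) (word_val u)) S w)"
proof -
  let ?f = "\<lambda>u. scaleQ (c u) (word_val u)"
  have "finite S \<and> 0 \<notin> S \<and> 0 \<notin> set w \<and> card S + length w \<le> m + n"
    if "(\<Sum>u\<in>{u \<in> U. coeff (?f u) S w \<noteq> 0}. coeff (?f u) S w) \<noteq> 0" for S w
  proof -
    from that obtain u where u: "u \<in> U" "coeff (?f u) S w \<noteq> 0"
      by (smt (verit) mem_Collect_eq sum.neutral)
    obtain a b where ab: "u = (a, b)" by force
    have "S = set a" "w = b"
      using u coeff_word_val_nonzero[of a b S w] by (auto simp: ab scaleQ.rep_eq)
    moreover have "length a = m" "length b = n" using u assms by (auto simp: ab words_def)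
    ultimately show ?thesis using coeff_nonzero[OF u(2)] card_length[of a] by auto
  qed
  then have "(\<lambda>S w. \<Sum>u\<in>{u \<in> U. coeff (?f u) S w \<noteq> 0}. coeff (?f u) S w) \<in>
      {f. \<exists>d. \<forall>S w. f S w \<noteq> 0 \<longrightarrow> finite S \<and> 0 \<notin> S \<and> 0 \<notin> set w \<and> card S + length w \<le> d}"
    by blast
  then show ?thesis unfolding formal_sum_def by (subst Abs_sseries_inverse) auto
qed


section \<open>Partial set supercompositions\<close>

text \<open>
  Tuples are lists: the block with 1-based number \<open>i\<close> is \<open>K ! (i - 1)\<close>, and the nonfermionic blocks
  of \<open>K\<close> are the entries of \<open>drop m K\<close>.
\<close>

definition supercomps :: "nat \<Rightarrow> nat \<Rightarrow> nat set list set" where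
  "supercomps n m = {K.
     m \<le> length K \<and>
     (\<forall>B\<in>set K. B \<noteq> {} \<and> B \<subseteq> {0..n}) \<and>
     (\<Union>B\<in>set K. B - {0}) = {1..n} \<and>
     (\<forall>i<length K. \<forall>j<length K. i \<noteq> j \<longrightarrow> K ! i \<inter> K ! j \<subseteq> {0}) \<and>
     (\<forall>i<length K. 0 \<in> K ! i \<longleftrightarrow> i < m) \<and>
     sorted_wrt (\<lambda>A B. Min A < Min B) (drop m K)}"

definition min0 :: "nat set \<Rightarrow> nat" where
  "min0 A = (if A = {} then 0 else Min A)"

definition superpartitions :: "nat \<Rightarrow> nat \<Rightarrow> nat set list set" where
  "superpartitions n m = {I \<in> supercomps n m. \<forall>i j. i < j \<and> j < length I \<longrightarrow>
     I ! i \<noteq> I ! j \<and> min0 (I ! i - I ! j) < min0 (I ! j - I ! i)}"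

definition sc_le :: "nat \<Rightarrow> nat set list \<Rightarrow> nat set list \<Rightarrow> bool" where
  "sc_le m K L \<longleftrightarrow>
     (\<forall>i<m. \<exists>J \<subseteq> set (drop m K). L ! i = K ! i \<union> \<Union>J) \<and>
     (\<forall>B\<in>set (drop m L). \<exists>J \<subseteq> set (drop m K). B = \<Union>J)"

definition sc_meet :: "nat \<Rightarrow> nat \<Rightarrow> nat set list \<Rightarrow> nat set list \<Rightarrow> nat set list" where
  "sc_meet n m K L = (THE N. N \<in> supercomps n m \<and> sc_le m N K \<and> sc_le m N L \<and>
     (\<forall>N'\<in>supercomps n m. sc_le m N' K \<and> sc_le m N' L \<longrightarrow> sc_le m N' N))"

definition sc_bot :: "nat \<Rightarrow> nat \<Rightarrow> nat set list" where
  "sc_bot n m = replicate m {0} @ map (\<lambda>i. {i}) [1..<Suc n]"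

definition sc_fact :: "nat set list \<Rightarrow> nat" where
  "sc_fact N = prod_list (map (\<lambda>B. fact (card B)) N)"

lemma sc_le_refl: "sc_le m K K"
proof -
  have "\<exists>J \<subseteq> set (drop m K). K ! i = K ! i \<union> \<Union>J" for i
    by (rule exI[of _ "{}"]) simp
  moreover have "\<exists>J \<subseteq> set (drop m K). B = \<Union>J" if "B \<in> set (drop m K)" for B
    by (rule exI[of _ "{B}"]) (use that in simp)
  ultimately show ?thesis unfolding sc_le_def by blast
qed

lemma sc_le_trans:
  assumes KL: "sc_le m K L" and LN: "sc_le m L N"
  shows "sc_le m K N"
proof -
  from KL obtain F where F: "\<And>B. B \<in> set (drop m L) \<Longrightarrow> F B \<subseteq> set (drop m K) \<and> B = \<Union>(F B)"
    unfolding sc_le_def by metis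
  have Un: "\<Union>J = \<Union>(\<Union>(F ` J))" "\<Union>(F ` J) \<subseteq> set (drop m K)" if "J \<subseteq> set (drop m L)" for J
  proof -
    have "\<Union>J = (\<Union>B\<in>J. \<Union>(F B))" using F that by (metis (no_types, lifting) SUP_cong subsetD image_ident)
    then show "\<Union>J = \<Union>(\<Union>(F ` J))" by auto
    show "\<Union>(F ` J) \<subseteq> set (drop m K)" using F that by blast
  qed
  show ?thesis
    unfolding sc_le_def
  proof (intro conjI allI ballI impI)
    fix i assume "i < m"
    then obtain J J' where "J \<subseteq> set (drop m K)" "L ! i = K ! i \<union> \<Union>J"
      and "J' \<subseteq> set (drop m L)" "N ! i = L ! i \<union> \<Union>J'"
      using KL LN unfolding sc_le_def by meson
    then show "\<exists>J \<subseteq> set (drop m K). N ! i = K ! i \<union> \<Union>J"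
      using Un[of J'] by (intro exI[of _ "J \<union> \<Union>(F ` J')"]) auto
  next
    fix B assume "B \<in> set (drop m N)"
    then obtain J' where "J' \<subseteq> set (drop m L)" "B = \<Union>J'"
      using LN unfolding sc_le_def by meson
    then show "\<exists>J \<subseteq> set (drop m K). B = \<Union>J"
      using Un[of J'] by blast
  qed
qed

lemma sorted_wrt_Min_unique:
  fixes xs ys :: "nat set list"
  assumes "sorted_wrt (\<lambda>A B. Min A < Min B) xs" "sorted_wrt (\<lambda>A B. Min A < Min B) ys"
    and "set xs = set ys"
  shows "xs = ys"
  using assms
proof (induction xs arbitrary: ys)
  case (Cons x xs)
  then obtain y ys' where ys: "ys = y # ys'" by (cases ys) auto
  have "x = y"
  proof (rule ccontr)
    assume "x \<noteq> y"
    then have "x \<in> set ys'" "y \<in> set xs" using Cons.prems(3) unfolding ys by auto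
    then have "Min y < Min x" "Min x < Min y" using Cons.prems(1,2) unfolding ys by auto
    then show False by simp
  qed
  moreover have "x \<notin> set xs" "y \<notin> set ys'"
    using Cons.prems(1,2) unfolding ys by auto
  ultimately have "set xs = set ys'" using Cons.prems(3) unfolding ys by auto
  then have "xs = ys'" using Cons.IH[of ys'] Cons.prems(1,2) unfolding ys by simp
  with \<open>x = y\<close> show ?case unfolding ys by simp
qed simp

lemma supercomps_drop:
  assumes "K \<in> supercomps n m" "B \<in> set (drop m K)" "C \<in> set (drop m K)"
  shows "B \<noteq> {}" and "B \<inter> C \<noteq> {} \<Longrightarrow> B = C"
proof -
  have *: "\<exists>i. m \<le> i \<and> i < length K \<and> B = K ! i" if BK: "B \<in> set (drop m K)" for B
  proof -
    obtain k where "k < length K - m" "B = drop m K ! k"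
      using BK unfolding in_set_conv_nth by (metis length_drop)
    moreover have "m \<le> length K" using assms(1) by (simp add: supercomps_def)
    ultimately show ?thesis by (intro exI[of _ "m + k"]) simp
  qed
  show "B \<noteq> {}" using assms(1,2) by (auto simp: supercomps_def dest: in_set_dropD)
  assume "B \<inter> C \<noteq> {}"
  moreover obtain i j where "m \<le> i" "i < length K" "B = K ! i" "m \<le> j" "j < length K" "C = K ! j"
    using *[OF assms(2)] *[OF assms(3)] by blast
  ultimately show "B = C"
  proof (cases "i = j")
    case False
    then have "B \<inter> C \<subseteq> {0}" "0 \<notin> B"
      using assms(1) \<open>m \<le> i\<close> \<open>i < length K\<close> \<open>B = K ! i\<close> \<open>j < length K\<close> \<open>C = K ! j\<close>
      by (simp_all add: supercomps_def)
    then show ?thesis using \<open>B \<inter> C \<noteq> {}\<close> by auto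
  qed simp
qed

lemma sc_le_antisym:
  assumes K: "K \<in> supercomps n m" and L: "L \<in> supercomps n m"
    and KL: "sc_le m K L" and LK: "sc_le m L K"
  shows "K = L"
proof -
  have *: "set (drop m L) \<subseteq> set (drop m K)"
    if K: "K \<in> supercomps n m" and L: "L \<in> supercomps n m"
      and KL: "sc_le m K L" and LK: "sc_le m L K" for K L
  proof
    fix B assume B: "B \<in> set (drop m L)"
    then obtain J where J: "J \<subseteq> set (drop m K)" "B = \<Union>J" using KL unfolding sc_le_def by meson
    with supercomps_drop(1)[OF L B B] obtain C where C: "C \<in> J" by auto
    then have CK: "C \<in> set (drop m K)" "C \<subseteq> B" using J by auto
    then obtain J' where J': "J' \<subseteq> set (drop m L)" "C = \<Union>J'"
      using LK unfolding sc_le_def by meson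
    with supercomps_drop(1)[OF K CK(1) CK(1)] obtain B' where "B' \<in> J'" "B' \<noteq> {}" by auto
    then have "B' \<in> set (drop m L)" "B' \<subseteq> C" "B \<inter> B' \<noteq> {}" using J' CK(2) by auto
    then have "B = B'" using supercomps_drop(2)[OF L B] by blast
    then show "B \<in> set (drop m K)" using CK \<open>B' \<subseteq> C\<close> by auto
  qed
  have "set (drop m K) = set (drop m L)" using *[OF K L KL LK] *[OF L K LK KL] by auto
  then have "drop m K = drop m L"
    using K L by (intro sorted_wrt_Min_unique) (auto simp: supercomps_def)
  moreover have "take m K = take m L"
  proof (rule nth_equalityI)
    fix i assume "i < length (take m K)"
    then have "i < m" by simp
    then have "K ! i \<subseteq> L ! i" "L ! i \<subseteq> K ! i" using KL LK unfolding sc_le_def by blast+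
    then show "take m K ! i = take m L ! i" using \<open>i < m\<close> by auto
  qed (use K L in \<open>auto simp: supercomps_def\<close>)
  ultimately show ?thesis by (metis append_take_drop_id)
qed

lemma finite_supercomps: "finite (supercomps n m)"
proof (rule finite_subset)
  show "supercomps n m \<subseteq> {K. set K \<subseteq> Pow {0..n} \<and> length K \<le> m + card (Pow {0..n})}"
  proof (intro subsetI CollectI conjI)
    fix K assume K: "K \<in> supercomps n m"
    show "B \<in> Pow {0..n}" if "B \<in> set K" for B using K that by (auto simp: supercomps_def)
    have "sorted_wrt (\<noteq>) (drop m K)"
      using K by (auto simp: supercomps_def intro: sorted_wrt_mono_rel[rotated])
    then have "distinct (drop m K)"
      by (auto simp: sorted_wrt_iff_nth_less distinct_conv_nth nat_neq_iff)
    moreover have "set (drop m K) \<subseteq> Pow {0..n}"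
      using K by (auto simp: supercomps_def dest!: in_set_dropD)
    ultimately have "length (drop m K) \<le> card (Pow {0..n})"
      by (metis card_mono distinct_card finite_Pow_iff finite_atLeastAtMost)
    then show "length K \<le> m + card (Pow {0..n})" by simp
  qed
  show "finite {K. set K \<subseteq> Pow {0..n} \<and> length K \<le> m + card (Pow {0..n})}"
    by (intro finite_lists_length_le) simp
qed

text \<open>The Moebius function, extended by 0 to pairs that are not comparable elements of the poset.\<close>

function moebius :: "nat \<Rightarrow> nat \<Rightarrow> nat set list \<Rightarrow> nat set list \<Rightarrow> int" where
  "moebius n m K L =
    (if K \<notin> supercomps n m \<or> L \<notin> supercomps n m \<or> \<not> sc_le m K L then 0
     else if K = L then 1
     else - (\<Sum>N\<in>{N \<in> supercomps n m. sc_le m K N \<and> sc_le m N L \<and> N \<noteq> L}. moebius n m K N))"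
  by pat_completeness auto
termination
proof (relation "measure (\<lambda>(n, m, K, L). card {N \<in> supercomps n m. sc_le m N L})", goal_cases)
  case (2 n m K L N)
  then have N: "N \<in> supercomps n m" "sc_le m N L" "N \<noteq> L" and L: "L \<in> supercomps n m" by auto
  have "{N' \<in> supercomps n m. sc_le m N' N} \<subset> {N' \<in> supercomps n m. sc_le m N' L}"
    using N L sc_le_antisym[OF N(1) L N(2)] sc_le_trans[OF _ N(2)] sc_le_refl[of m L] by blast
  then show ?case by (simp add: psubset_card_mono finite_supercomps)
qed simp

declare moebius.simps [simp del]


section \<open>The symmetric functions\<close>

text \<open>
  For a word \<open>(a, b)\<close>, the letter \<open>a\<^sub>i\<close> (1-based, \<open>i \<in> [m]\<close>) is \<open>a ! (i - 1)\<close>, hence the index \<open>i < m\<close>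
  below also addresses the fermionic block \<open>K ! i\<close>; the letter \<open>b\<^sub>j\<close> (\<open>j \<in> [n]\<close>) is \<open>b ! (j - 1)\<close>.
\<close>

definition same_block :: "nat set list \<Rightarrow> nat \<Rightarrow> nat \<Rightarrow> bool" where
  "same_block K i j \<longleftrightarrow> (\<exists>B\<in>set K. i \<in> B \<and> j \<in> B)"

definition M_words :: "nat \<Rightarrow> nat \<Rightarrow> nat set list \<Rightarrow> sword set" where
  "M_words n m K = {(a, b) \<in> words n m.
     (\<forall>i<m. \<forall>j\<in>{1..n}. a ! i = b ! (j - 1) \<longleftrightarrow> j \<in> K ! i - {0}) \<and>
     (\<forall>i\<in>{1..n}. \<forall>j\<in>{1..n}. b ! (i - 1) = b ! (j - 1) \<longleftrightarrow> same_block K i j)}"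

definition m_fun :: "nat \<Rightarrow> nat \<Rightarrow> nat set list \<Rightarrow> sseries" where
  "m_fun n m K = formal_sum word_val (M_words n m K)"

definition p_fun :: "nat \<Rightarrow> nat \<Rightarrow> nat set list \<Rightarrow> sseries" where
  "p_fun n m K = formal_sum word_val {(a, b) \<in> words n m.
     (\<forall>i<m. \<forall>j\<in>K ! i - {0}. a ! i = b ! (j - 1)) \<and>
     (\<forall>i\<in>{1..n}. \<forall>j\<in>{1..n}. same_block K i j \<longrightarrow> b ! (i - 1) = b ! (j - 1))}"

definition e_fun :: "nat \<Rightarrow> nat \<Rightarrow> nat set list \<Rightarrow> sseries" where
  "e_fun n m K = formal_sum word_val {(a, b) \<in> words n m.
     (\<forall>i<m. \<forall>j\<in>K ! i - {0}. a ! i \<noteq> b ! (j - 1)) \<and>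
     (\<forall>i\<in>{1..n}. \<forall>j\<in>{1..n}. i \<noteq> j \<and> same_block K i j \<longrightarrow> b ! (i - 1) \<noteq> b ! (j - 1))}"

definition word_type :: "nat \<Rightarrow> nat \<Rightarrow> sword \<Rightarrow> nat set list" where
  "word_type n m u = (THE L. L \<in> supercomps n m \<and> u \<in> M_words n m L)"

definition h_fun :: "nat \<Rightarrow> nat \<Rightarrow> nat set list \<Rightarrow> sseries" where
  "h_fun n m K = formal_sum
     (\<lambda>u. scaleQ (of_nat (sc_fact (sc_meet n m K (word_type n m u)))) (word_val u))
     {(a, b) \<in> words n m. distinct a \<and> card (set a - set b) \<le> 1}"

end

theory Submission
  imports Defs "HOL-Library.Disjoint_Sets"
begin

text \<open>
  Giving each of the \<open>m\<close> zeros its own name turns a partial set supercomposition into a set partition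
  of \<open>m + n\<close> points in which no two zeros share a block, and \<open>sc_le\<close> into refinement.  A word with
  distinct \<open>\<theta>\<close>-letters (the others vanish) has a type \<open>T\<close>, and its coefficient in \<open>p_fun\<close>, \<open>e_fun\<close>,
  \<open>h_fun\<close> at \<open>K\<close> is \<open>[K \<sqsubseteq> T]\<close>, \<open>[K \<sqinter> T = 0]\<close>, \<open>(K \<sqinter> T)!\<close> respectively.  The first identity is
  Moebius inversion.  The last two coefficients are the sums of \<open>\<mu>(0, N)\<close> and \<open>\<bar>\<mu>(0, N)\<bar>\<close> over
  \<open>N \<sqsubseteq> K \<sqinter> T\<close>, the latter because a permutation preserving all blocks is a choice of a cyclic
  order on each block of a refinement; Moebius inversion in \<open>K\<close> then turns the inner sums into
  \<open>\<mu>(0, L)\<close> or \<open>\<bar>\<mu>(0, L)\<bar>\<close> times \<open>p_fun\<close> at \<open>L\<close>.  That \<open>I\<close> is a superpartition is needed for \<open>h_fun\<close>,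
  which omits the words with two \<open>\<theta>\<close>-letters that do not occur among the \<open>x\<close>-letters.
\<close>

section \<open>Enumeration of refinements by cycle weights\<close>

text \<open>These are the refinements of the partition of \<open>A\<close> into the colour classes
  of \<open>c\<close>. Encoding the coarser partition by a colouring lets an induction on
  \<open>A\<close> keep \<open>c\<close> fixed.\<close>

definition mono_partitions :: "('a \<Rightarrow> 'c) \<Rightarrow> 'a set \<Rightarrow> 'a set set set" where
  "mono_partitions c A = {P. partition_on A P \<and> (\<forall>B\<in>P. \<forall>x\<in>B. \<forall>y\<in>B. c x = c y)}"

lemma partition_onD_unique:
  "partition_on A P \<Longrightarrow> B \<in> P \<Longrightarrow> C \<in> P \<Longrightarrow> x \<in> B \<Longrightarrow> x \<in> C \<Longrightarrow> B = C"
  by (auto simp: partition_on_def disjoint_def)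

lemma partition_on_Diff_block:
  assumes "partition_on A P" "C \<in> P"
  shows "partition_on (A - C) (P - {C})"
proof -
  have "disjnt C (\<Union>(P - {C}))"
    using assms by (auto simp: partition_on_def disjoint_def disjnt_def)
  moreover have "insert C (P - {C}) = P" using assms by auto
  ultimately show ?thesis using partition_on_insert[of C "P - {C}" A] assms by simp
qed

lemma finite_mono_partitions: "finite A \<Longrightarrow> finite (mono_partitions c A)"
  by (rule finite_subset[OF _ finitely_many_partition_on]) (auto simp: mono_partitions_def)

text \<open>A new point opens its own block (\<open>C = {}\<close>) or joins a block
  \<open>C\<close> of its own colour. Since \<open>{}\<close> is never a block, removing it from
  \<open>P\<close> changes nothing, and one formula covers both cases.\<close>

lemma mono_partitions_add:
  assumes "a \<notin> A" "P \<in> mono_partitions c A" "C = {} \<or> C \<in> P \<and> (\<forall>y\<in>C. c y = c a)"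
  shows "insert (insert a C) (P - {C}) \<in> mono_partitions c (insert a A)"
proof -
  have P: "partition_on A P" using assms by (simp add: mono_partitions_def)
  have "partition_on (A - C) (P - {C})"
  proof (cases "C = {}")
    case True
    with P show ?thesis by (simp add: partition_on_def)
  next
    case False
    with assms have "C \<in> P" by simp
    with P show ?thesis by (rule partition_on_Diff_block)
  qed
  moreover have "disjnt (insert a C) (\<Union>(P - {C}))"
    using P assms unfolding partition_on_def disjoint_def disjnt_def by blast
  moreover have "C \<subseteq> A" using assms P by (auto simp: partition_on_def)
  moreover have "insert a A - insert a C = A - C" using \<open>a \<notin> A\<close> by auto
  ultimately have "partition_on (insert a A) (insert (insert a C) (P - {C}))"
    by (subst partition_on_insert) auto
  moreover have "c x = c y" if "B \<in> insert (insert a C) (P - {C})" "x \<in> B" "y \<in> B" for B x y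
  proof (cases "B = insert a C")
    case True
    then have "c x = c a" "c y = c a" using that assms(3) by blast+
    then show ?thesis by simp
  next
    case False
    then show ?thesis using that assms(2) unfolding mono_partitions_def by blast
  qed
  ultimately show ?thesis unfolding mono_partitions_def by blast
qed

text \<open>The inverse of inserting a point: \<open>{D - {a}} - {{}}\<close> contributes no block
  when \<open>a\<close> was alone, and otherwise the rest of its block.\<close>

lemma mono_partitions_remove:
  assumes "a \<notin> A" "P \<in> mono_partitions c (insert a A)" "D \<in> P" "a \<in> D"
  shows "P - {D} \<union> ({D - {a}} - {{}}) \<in> mono_partitions c A"
proof -
  have P: "partition_on (insert a A) P" using assms by (simp add: mono_partitions_def)
  have "partition_on (insert a A - D) (P - {D})"
    using P \<open>D \<in> P\<close> by (rule partition_on_Diff_block)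
  moreover have "insert a A - D = A - (D - {a})" using assms by auto
  moreover have "disjnt (D - {a}) (\<Union>(P - {D}))"
    using P assms unfolding partition_on_def disjoint_def disjnt_def by blast
  moreover have "D - {a} \<subseteq> A" using assms P by (auto simp: partition_on_def)
  ultimately have "partition_on A (P - {D} \<union> ({D - {a}} - {{}}))"
    using partition_on_insert[of "D - {a}" "P - {D}" A] by (cases "D - {a} = {}") (simp_all add: Un_commute)
  moreover have "c x = c y" if "B \<in> P - {D} \<union> ({D - {a}} - {{}})" "x \<in> B" "y \<in> B" for B x y
    using that assms(2,3) unfolding mono_partitions_def by blast
  ultimately show ?thesis unfolding mono_partitions_def by blast
qed

text \<open>A block of size \<open>k\<close> has \<open>(k - 1)!\<close> cyclic orders, so the left
  side enumerates the permutations preserving every colour class, weighted by \<open>x\<close> to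
  the number of cycles. A new point either starts a cycle, with factor \<open>x\<close>, or enters a
  cycle \<open>C\<close> of its colour at one of \<open>card C\<close> places. This multiplies the
  total by \<open>x\<close> plus the number of earlier points of that colour, the next factor of the
  rising factorial.\<close>

lemma sum_prod_fact_mono_partitions:
  fixes x :: "'b :: {comm_semiring_1, semiring_char_0}"
  assumes "finite A" "finite Q" "c ` A \<subseteq> Q"
  shows "(\<Sum>P\<in>mono_partitions c A. \<Prod>B\<in>P. x * fact (card B - 1)) =
    (\<Prod>k\<in>Q. pochhammer x (card {y \<in> A. c y = k}))"
  using assms(1,3)
proof (induction A rule: finite_induct)
  case empty
  have "mono_partitions c {} = {{}}"
    by (auto simp: mono_partitions_def partition_on_empty)
  then show ?case by simp
next
  case (insert a A)
  define w :: "'a set set \<Rightarrow> 'b" where "w P = (\<Prod>B\<in>P. x * fact (card B - 1))" for P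
  define F where "F P = {B \<in> P. \<forall>y\<in>B. c y = c a}" for P
  \<comment> \<open>For a partition \<open>P\<close> of \<open>insert a A\<close> this union has a
    single member, the block containing \<open>a\<close>.\<close>
  define D where "D P = \<Union>{B \<in> P. a \<in> B}" for P
  have fin: "finite P" "finite B" if "P \<in> mono_partitions c A" "B \<in> P" for P B
    using that insert.hyps
    by (auto simp: mono_partitions_def partition_on_def intro: finite_UnionD finite_subset)
  have finP: "finite P" if "P \<in> mono_partitions c A" for P
    using that insert.hyps by (auto simp: mono_partitions_def partition_on_def intro: finite_UnionD)
  have notin: "a \<notin> B" if "P \<in> mono_partitions c A" "B \<in> P" for P B
    using that insert.hyps by (auto simp: mono_partitions_def partition_on_def)
  have notemp: "{} \<notin> P" if "P \<in> mono_partitions c A" for P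
    using that by (auto simp: mono_partitions_def partition_on_def)
  have D: "D P \<in> P" "a \<in> D P" and D_eq: "\<And>B. B \<in> P \<Longrightarrow> a \<in> B \<Longrightarrow> D P = B"
    if P: "P \<in> mono_partitions c (insert a A)" for P
  proof -
    have p: "partition_on (insert a A) P" using P by (simp add: mono_partitions_def)
    then obtain B where B: "B \<in> P" "a \<in> B" by (auto simp: partition_on_def)
    then have "{B \<in> P. a \<in> B} = {B}" using partition_onD_unique[OF p] by blast
    then have "D P = B" by (simp add: D_def)
    with B show "D P \<in> P" "a \<in> D P" by auto
    show "D P = B" if "B \<in> P" "a \<in> B" for B
      using partition_onD_unique[OF p \<open>D P \<in> P\<close> that(1) \<open>a \<in> D P\<close> that(2)] .
  qed
  have D_notin: "D P - {a} \<notin> P - {D P}" if P: "P \<in> mono_partitions c (insert a A)" for P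
  proof
    assume *: "D P - {a} \<in> P - {D P}"
    have p: "partition_on (insert a A) P" using P by (simp add: mono_partitions_def)
    then have "D P - {a} \<noteq> {}" using * unfolding partition_on_def by (metis Diff_iff)
    then obtain y where "y \<in> D P - {a}" by blast
    then have "D P - {a} = D P" using partition_onD_unique[OF p] * D[OF P] by blast
    with D[OF P] show False by blast
  qed
  have "(\<Sum>P\<in>mono_partitions c (insert a A). w P) =
    (\<Sum>(P, C)\<in>(SIGMA P:mono_partitions c A. insert {} (F P)). w (insert (insert a C) (P - {C})))"
  \<comment> \<open>A partition of the larger set corresponds to what is left of it after deleting
    \<open>a\<close>, together with the rest of the block of \<open>a\<close>, which is
    \<open>{}\<close> if \<open>a\<close> was alone.\<close>
  proof (rule sum.reindex_bij_witness[where i = "\<lambda>(P, C). insert (insert a C) (P - {C})"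
        and j = "\<lambda>P. (P - {D P} \<union> ({D P - {a}} - {{}}), D P - {a})"], goal_cases)
    case (1 P)
    note d = D[OF 1]
    have "D P - {a} \<notin> P - {D P}" using D_notin[OF 1] .
    then show ?case using d by (auto simp: insert_absorb)
  next
    case (2 P)
    note d = D[OF 2]
    have "\<forall>y\<in>D P - {a}. c y = c a" using d 2 unfolding mono_partitions_def by blast
    then have "D P - {a} \<in> insert {} (F (P - {D P} \<union> ({D P - {a}} - {{}})))"
      unfolding F_def by (cases "D P - {a} = {}") simp_all
    then show ?case
      using mono_partitions_remove[OF insert.hyps(2) 2 d] by blast
  next
    case (3 X)
    then obtain P C where X: "X = (P, C)" "P \<in> mono_partitions c A" "C \<in> insert {} (F P)" by auto
    let ?P = "insert (insert a C) (P - {C})"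
    have "D ?P = insert a C"
    proof (rule D_eq)
      show "?P \<in> mono_partitions c (insert a A)"
        using X insert.hyps by (intro mono_partitions_add) (auto simp: F_def)
    qed auto
    moreover have "insert a C - {a} = C" using X notin[of P C] by (auto simp: F_def)
    moreover have "?P - {insert a C} = P - {C}" using notin[OF X(2)] by blast
    moreover have "P - {C} \<union> ({C} - {{}}) = P" using X notemp[OF X(2)] unfolding F_def by blast
    ultimately show ?case using X(1) by simp
  next
    case (4 X)
    then obtain P C where X: "X = (P, C)" "P \<in> mono_partitions c A" "C \<in> insert {} (F P)" by auto
    then have "C = {} \<or> C \<in> P \<and> (\<forall>y\<in>C. c y = c a)" unfolding F_def by blast
    then show ?case using mono_partitions_add[OF insert.hyps(2) X(2)] X(1) by simp
  next
    case (5 P)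
    note d = D[OF 5]
    have "D P - {a} \<notin> P - {D P}" using D_notin[OF 5] .
    then have "insert (insert a (D P - {a})) (P - {D P} \<union> ({D P - {a}} - {{}}) - {D P - {a}}) = P"
      using d by (auto simp: insert_absorb)
    then show ?case by simp
  qed
  also have "\<dots> = (\<Sum>P\<in>mono_partitions c A. \<Sum>C\<in>insert {} (F P). w (insert (insert a C) (P - {C})))"
    by (rule sum.Sigma[symmetric])
       (use insert.hyps finP in \<open>auto simp: finite_mono_partitions F_def\<close>)
  also have "\<dots> = (\<Sum>P\<in>mono_partitions c A. w P * (x + of_nat (card {y \<in> A. c y = c a})))"
  proof (rule sum.cong[OF refl])
    fix P assume P: "P \<in> mono_partitions c A"
    have p: "partition_on A P" using P by (simp add: mono_partitions_def)
    have fact_pos: "fact k = of_nat k * (fact (k - 1) :: 'b)" if "k > 0" for k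
      using that by (cases k) auto
    \<comment> \<open>Joining \<open>C\<close> turns the factor \<open>(card C - 1)!\<close> into
      \<open>(card C)!\<close>, hence the ratio \<open>card C\<close>.\<close>
    have w1: "w (insert (insert a C) (P - {C})) = (if C = {} then x else of_nat (card C)) * w P"
      if C: "C \<in> insert {} (F P)" for C
    proof -
      have a: "insert a C \<notin> P" "a \<notin> C" using notin[OF P] C by (auto simp: F_def)
      have "finite C" using C fin[OF P] by (auto simp: F_def)
      then have "w (insert (insert a C) (P - {C})) = x * fact (card C) * w (P - {C})"
        using a finP[OF P] by (simp add: w_def)
      also have "\<dots> = (if C = {} then x else of_nat (card C)) * w P"
      proof (cases "C = {}")
        case True
        then show ?thesis using notemp[OF P] by simp
      next
        case False
        then have CP: "C \<in> P" and "card C > 0"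
          using C \<open>finite C\<close> by (auto simp: F_def card_gt_0_iff)
        have "w P = x * fact (card C - 1) * w (P - {C})"
          unfolding w_def using CP finP[OF P] by (simp add: prod.remove)
        then show ?thesis using False fact_pos[OF \<open>card C > 0\<close>] by (simp add: mult_ac)
      qed
      finally show ?thesis .
    qed
    \<comment> \<open>The blocks that \<open>a\<close> may join partition its colour class, so their
      sizes add up to the size of that class.\<close>
    have U: "{y \<in> A. c y = c a} = \<Union>(F P)"
    proof (intro equalityI subsetI)
      fix y assume y: "y \<in> {y \<in> A. c y = c a}"
      then obtain B where B: "B \<in> P" "y \<in> B" using p by (auto simp: partition_on_def)
      have "c z = c a" if "z \<in> B" for z
      proof -
        have "c z = c y" using P B that unfolding mono_partitions_def by blast
        with y show ?thesis by simp
      qed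
      with B show "y \<in> \<Union>(F P)" unfolding F_def by blast
    qed (use p in \<open>auto simp: F_def partition_on_def\<close>)
    have "card {y \<in> A. c y = c a} = (\<Sum>B\<in>F P. card B)"
      unfolding U using p fin[OF P]
      by (intro card_Union_disjoint) (auto simp: partition_on_def disjoint_def F_def pairwise_def)
    moreover have "{} \<notin> F P" using notemp[OF P] by (auto simp: F_def)
    moreover have "finite (F P)" using finP[OF P] by (simp add: F_def)
    moreover have "(\<Sum>C\<in>insert {} (F P). w (insert (insert a C) (P - {C}))) =
        (\<Sum>C\<in>insert {} (F P). if C = {} then x * w P else of_nat (card C) * w P)"
      by (rule sum.cong[OF refl]) (simp only: w1 split: if_splits, simp)
    moreover have "(\<Sum>C\<in>F P. if C = {} then x * w P else of_nat (card C) * w P) =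
        (\<Sum>C\<in>F P. of_nat (card C) * w P)"
      using \<open>{} \<notin> F P\<close> by (intro sum.cong) auto
    ultimately show "(\<Sum>C\<in>insert {} (F P). w (insert (insert a C) (P - {C}))) =
        w P * (x + of_nat (card {y \<in> A. c y = c a}))"
      by (simp add: algebra_simps sum_distrib_left)
  qed
  also have "\<dots> = (\<Prod>k\<in>Q. pochhammer x (card {y \<in> A. c y = k})) *
      (x + of_nat (card {y \<in> A. c y = c a}))"
    using insert by (simp add: sum_distrib_right[symmetric] w_def)
  also have "\<dots> = (\<Prod>k\<in>Q. pochhammer x (card {y \<in> insert a A. c y = k}))"
  proof -
    have ca: "c a \<in> Q" using insert.prems by auto
    have 1: "card {y \<in> insert a A. c y = k} = card {y \<in> A. c y = k}" if "k \<noteq> c a" for k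
      using that by (intro arg_cong[where f = card]) auto
    have "{y \<in> insert a A. c y = c a} = insert a {y \<in> A. c y = c a}" by auto
    then have 2: "card {y \<in> insert a A. c y = c a} = Suc (card {y \<in> A. c y = c a})"
      using insert.hyps by simp
    have 3: "(\<Prod>k\<in>Q - {c a}. pochhammer x (card {y \<in> insert a A. c y = k})) =
        (\<Prod>k\<in>Q - {c a}. pochhammer x (card {y \<in> A. c y = k}))"
      using 1 by (intro prod.cong) auto
    show ?thesis
      unfolding prod.remove[OF assms(2) ca] 2 3 pochhammer_Suc by (simp add: mult_ac)
  qed
  finally show ?case by (simp add: w_def)
qed

section \<open>Supercompositions as set partitions\<close>

text \<open>Refinements, meets and word types are all compared through this relation, which avoids
  handling blocks and their positions in a list.\<close>

definition linked :: "'a set set \<Rightarrow> 'a \<Rightarrow> 'a \<Rightarrow> bool" where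
  "linked P x y \<longleftrightarrow> (\<exists>B\<in>P. x \<in> B \<and> y \<in> B)"

lemma linked_sym: "linked P x y \<Longrightarrow> linked P y x"
  by (auto simp: linked_def)

lemma linked_trans: "partition_on A P \<Longrightarrow> linked P x y \<Longrightarrow> linked P y z \<Longrightarrow> linked P x z"
  unfolding linked_def by (metis partition_onD_unique)

lemma linked_refl: "partition_on A P \<Longrightarrow> linked P x x \<longleftrightarrow> x \<in> A"
  by (auto simp: linked_def partition_on_def)

lemma linked_in_ground: "partition_on A P \<Longrightarrow> linked P x y \<Longrightarrow> x \<in> A \<and> y \<in> A"
  by (auto simp: linked_def partition_on_def)

section \<open>Renaming the zeros\<close>

text \<open>\<open>Inl i\<close> stands for the zero of the fermionic block at list index
  \<open>i\<close>, and \<open>Inr j\<close> for the element \<open>j\<close> of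
  \<open>[n]\<close>.\<close>

definition ground :: "nat \<Rightarrow> nat \<Rightarrow> (nat + nat) set" where
  "ground n m = Inl ` {..<m} \<union> Inr ` {1..n}"

definition padded :: "nat \<Rightarrow> nat set list \<Rightarrow> nat \<Rightarrow> (nat + nat) set" where
  "padded m K k = (if k < m then {Inl k} else {}) \<union> Inr ` (K ! k - {0})"

definition parts :: "nat \<Rightarrow> nat set list \<Rightarrow> (nat + nat) set set" where
  "parts m K = padded m K ` {..<length K}"

lemma in_padded:
  "Inl i \<in> padded m K k \<longleftrightarrow> k < m \<and> i = k"
  "Inr j \<in> padded m K k \<longleftrightarrow> j \<in> K ! k \<and> j \<noteq> 0"
  by (auto simp: padded_def)

context
  fixes n m :: nat and K :: "nat set list"
  assumes K: "K \<in> supercomps n m"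
begin

lemma supercomps_length: "m \<le> length K"
  using K by (simp add: supercomps_def)

lemma supercomps_nth: "k < length K \<Longrightarrow> K ! k \<noteq> {} \<and> K ! k \<subseteq> {0..n}"
  using K by (simp add: supercomps_def)

lemma supercomps_zero: "k < length K \<Longrightarrow> 0 \<in> K ! k \<longleftrightarrow> k < m"
  using K by (simp add: supercomps_def)

lemma supercomps_nth_unique:
  assumes "k < length K" "l < length K" "j \<in> K ! k" "j \<in> K ! l" "j \<noteq> 0"
  shows "k = l"
proof (rule ccontr)
  assume "k \<noteq> l"
  then have "K ! k \<inter> K ! l \<subseteq> {0}" using K assms by (simp add: supercomps_def)
  with assms show False by auto
qed

lemma supercomps_nth_ex:
  assumes "j \<in> {1..n}"
  obtains k where "k < length K" "j \<in> K ! k"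
proof -
  have "j \<in> (\<Union>B\<in>set K. B - {0})" using K assms by (simp add: supercomps_def)
  then show ?thesis using that by (auto simp: in_set_conv_nth)
qed

lemma padded_nonempty: "k < length K \<Longrightarrow> padded m K k \<noteq> {}"
  using supercomps_nth[of k] supercomps_zero[of k] by (auto simp: padded_def)

lemma padded_unique:
  "k < length K \<Longrightarrow> l < length K \<Longrightarrow> x \<in> padded m K k \<Longrightarrow> x \<in> padded m K l \<Longrightarrow> k = l"
  using supercomps_nth_unique by (cases x) (auto simp: in_padded)

text \<open>A tuple may contain the block \<open>{0}\<close> several times. The separate names of
  the zeros keep these copies distinct, so the set \<open>parts m K\<close> loses no block and
  products over it agree with products over the list.\<close>

lemma inj_on_padded: "inj_on (padded m K) {..<length K}"
  using padded_unique padded_nonempty by (intro inj_onI) (metis lessThan_iff ex_in_conv)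

text \<open>The renamed zero still counts as a point, in accordance with the factorials in
  \<open>sc_fact\<close>.\<close>

lemma card_padded: "k < length K \<Longrightarrow> card (padded m K k) = card (K ! k)"
proof -
  assume k: "k < length K"
  have fin: "finite (K ! k)" using supercomps_nth[OF k] finite_subset by blast
  show ?thesis
  proof (cases "k < m")
    case True
    then have "K ! k = insert 0 (K ! k - {0})" using supercomps_zero[OF k] by auto
    then have "card (K ! k) = Suc (card (K ! k - {0}))"
      using fin by (metis card_insert_disjoint finite_Diff insertI1 Diff_iff)
    moreover have "padded m K k = insert (Inl k) (Inr ` (K ! k - {0}))"
      using True by (simp add: padded_def)
    ultimately show ?thesis using fin by (simp add: card_image image_iff)
  next
    case False
    then have "K ! k - {0} = K ! k" using supercomps_zero[OF k] by auto
    then show ?thesis using False by (simp add: padded_def card_image)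
  qed
qed

lemma partition_on_parts: "partition_on (ground n m) (parts m K)"
proof (rule partition_onI)
  show "\<Union>(parts m K) = ground n m"
  proof (intro equalityI subsetI)
    fix x assume "x \<in> \<Union>(parts m K)"
    then obtain k where "k < length K" "x \<in> padded m K k" by (auto simp: parts_def)
    then show "x \<in> ground n m"
      using supercomps_nth[of k] by (cases x) (fastforce simp: in_padded ground_def)+
  next
    fix x assume x: "x \<in> ground n m"
    show "x \<in> \<Union>(parts m K)"
    proof (cases x)
      case (Inl i)
      then have "i < length K" "x \<in> padded m K i"
        using x supercomps_length by (auto simp: ground_def in_padded)
      then show ?thesis by (auto simp: parts_def)
    next
      case (Inr j)
      then have j: "j \<in> {1..n}" using x by (auto simp: ground_def)
      obtain k where "k < length K" "j \<in> K ! k" using supercomps_nth_ex[OF j] .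
      then have "k < length K" "x \<in> padded m K k" using Inr j by (auto simp: in_padded)
      then show ?thesis by (auto simp: parts_def)
    qed
  qed
  show "disjnt p q" if "p \<in> parts m K" "q \<in> parts m K" "p \<noteq> q" for p q
    using that padded_unique by (fastforce simp: parts_def disjnt_def)
  show "{} \<notin> parts m K" using padded_nonempty by (auto simp: parts_def)
qed

lemma linked_parts_Inl_Inl: "linked (parts m K) (Inl i) (Inl j) \<longleftrightarrow> i < m \<and> j = i"
  using supercomps_length by (auto simp: linked_def parts_def in_padded)

lemma linked_parts_Inl_Inr: "linked (parts m K) (Inl i) (Inr j) \<longleftrightarrow> i < m \<and> j \<in> K ! i - {0}"
  using supercomps_length by (auto simp: linked_def parts_def in_padded)

lemma linked_parts_Inr_Inr:
  "linked (parts m K) (Inr i) (Inr j) \<longleftrightarrow> i \<in> {1..n} \<and> j \<in> {1..n} \<and> same_block K i j"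
proof
  assume l: "linked (parts m K) (Inr i) (Inr j)"
  then have "Inr i \<in> ground n m" "Inr j \<in> ground n m"
    using linked_in_ground[OF partition_on_parts] by blast+
  with l show "i \<in> {1..n} \<and> j \<in> {1..n} \<and> same_block K i j"
    by (auto simp: ground_def linked_def parts_def in_padded same_block_def intro: nth_mem)
next
  assume "i \<in> {1..n} \<and> j \<in> {1..n} \<and> same_block K i j"
  then show "linked (parts m K) (Inr i) (Inr j)"
    by (force simp: linked_def parts_def in_padded same_block_def in_set_conv_nth)
qed

lemma prod_parts: "(\<Prod>B\<in>parts m K. f (card B)) = prod_list (map (\<lambda>B. f (card B)) K)"
proof -
  have "(\<Prod>B\<in>parts m K. f (card B)) = (\<Prod>k<length K. f (card (K ! k)))"
    unfolding parts_def by (subst prod.reindex[OF inj_on_padded]) (simp add: card_padded)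
  then show ?thesis by (simp add: prod.list_conv_set_nth atLeast0LessThan)
qed

end

lemma set_drop_conv_nth: "B \<in> set (drop m K) \<longleftrightarrow> (\<exists>k\<ge>m. k < length K \<and> B = K ! k)"
proof
  assume "B \<in> set (drop m K)"
  then obtain i where "i < length K - m" "B = K ! (m + i)"
    by (auto simp: in_set_conv_nth)
  then show "\<exists>k\<ge>m. k < length K \<and> B = K ! k" by (intro exI[of _ "m + i"]) auto
next
  assume "\<exists>k\<ge>m. k < length K \<and> B = K ! k"
  then obtain k where "m \<le> k" "k < length K" "B = K ! k" by blast
  then show "B \<in> set (drop m K)"
    by (auto simp: in_set_conv_nth intro!: exI[of _ "k - m"])
qed

text \<open>Fermionic blocks of \<open>K\<close> and \<open>L\<close> with the same index share the
  point \<open>Inl i\<close>, so refinement forces each fermionic block of \<open>K\<close> into the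
  block of \<open>L\<close> with its own index. The remaining points of a block of \<open>L\<close>
  are covered by whole nonfermionic blocks of \<open>K\<close>.\<close>

lemma sc_le_iff_linked:
  assumes K: "K \<in> supercomps n m" and L: "L \<in> supercomps n m"
  shows "sc_le m K L \<longleftrightarrow> (\<forall>x y. linked (parts m K) x y \<longrightarrow> linked (parts m L) x y)"
proof
  assume le: "sc_le m K L"
  have le1: "\<exists>J\<subseteq>set (drop m K). L ! i = K ! i \<union> \<Union>J" if "i < m" for i
    using le that by (simp add: sc_le_def)
  have le2: "\<exists>J\<subseteq>set (drop m K). B = \<Union>J" if "B \<in> set (drop m L)" for B
    using le that by (simp add: sc_le_def)
  show "\<forall>x y. linked (parts m K) x y \<longrightarrow> linked (parts m L) x y"
  proof (intro allI impI)
    fix x y assume "linked (parts m K) x y"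
    then obtain k where k: "k < length K" "x \<in> padded m K k" "y \<in> padded m K k"
      by (auto simp: linked_def parts_def)
    have "\<exists>l<length L. padded m K k \<subseteq> padded m L l"
    proof (cases "k < m")
      case True
      then have "K ! k \<subseteq> L ! k" using le1 by blast
      then have "padded m K k \<subseteq> padded m L k" by (auto simp: padded_def)
      then show ?thesis using True supercomps_length[OF L] by (intro exI[of _ k]) simp
    next
      case False
      then have "0 \<notin> K ! k" using supercomps_zero[OF K k(1)] by simp
      then obtain j where j: "j \<in> K ! k" "j \<noteq> 0" "j \<in> {1..n}"
        using supercomps_nth[OF K k(1)] by (fastforce simp: Suc_le_eq intro: gr0I)
      obtain l where l: "l < length L" "j \<in> L ! l" using supercomps_nth_ex[OF L j(3)] .
      \<comment> \<open>The block of \<open>L\<close> containing \<open>j\<close> is assembled from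
        blocks of \<open>K\<close>, and the piece containing \<open>j\<close> must be the
        nonfermionic block \<open>K ! k\<close>.\<close>
      have "\<exists>J\<subseteq>set (drop m K). j \<in> \<Union>J \<and> \<Union>J \<subseteq> L ! l"
      proof (cases "l < m")
        case True
        then obtain J where J: "J \<subseteq> set (drop m K)" "L ! l = K ! l \<union> \<Union>J"
          using le1 by blast
        have "j \<notin> K ! l"
          using supercomps_nth_unique[OF K k(1) _ j(1) _ j(2), of l] True False supercomps_length[OF K]
          by auto
        with J l show ?thesis by (intro exI[of _ J]) auto
      next
        case False
        then have "L ! l \<in> set (drop m L)" using l unfolding set_drop_conv_nth by (intro exI[of _ l]) simp
        then obtain J where "J \<subseteq> set (drop m K)" "L ! l = \<Union>J"
          using le2 by blast
        with l show ?thesis by (intro exI[of _ J]) auto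
      qed
      then obtain C where C: "C \<in> set (drop m K)" "j \<in> C" "C \<subseteq> L ! l" by blast
      then obtain k' where "k' < length K" "C = K ! k'" by (auto simp: set_drop_conv_nth)
      then have "C = K ! k" using supercomps_nth_unique[OF K k(1) _ j(1) _ j(2)] C by blast
      then have "padded m K k \<subseteq> padded m L l" using C False by (auto simp: padded_def)
      with l show ?thesis by blast
    qed
    with k show "linked (parts m L) x y" by (auto simp: linked_def parts_def)
  qed
next
  assume le: "\<forall>x y. linked (parts m K) x y \<longrightarrow> linked (parts m L) x y"
  have sub: "K ! k \<subseteq> L ! l"
    if k: "k < length K" "m \<le> k" and l: "l < length L" and j: "j \<in> K ! k" "j \<in> L ! l" "j \<noteq> 0" for k l j
  proof
    fix i assume i: "i \<in> K ! k"
    with k have "i \<noteq> 0" using supercomps_zero[OF K k(1)] by (intro notI) simp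
    then have "linked (parts m K) (Inr j) (Inr i)"
      using i j k by (auto simp: linked_def parts_def in_padded intro!: bexI[of _ k])
    then have "linked (parts m L) (Inr j) (Inr i)" using le by blast
    then obtain l' where "l' < length L" "j \<in> L ! l'" "i \<in> L ! l'"
      by (auto simp: linked_def parts_def in_padded)
    then show "i \<in> L ! l" using supercomps_nth_unique[OF L l _ j(2) _ j(3)] by blast
  qed
  have ferm: "K ! i \<subseteq> L ! i" if i: "i < m" for i
  proof
    fix j assume j: "j \<in> K ! i"
    have "i < length K" "i < length L"
      using i supercomps_length[OF K] supercomps_length[OF L] by auto
    then show "j \<in> L ! i"
      using le[rule_format, of "Inl i" "Inr j"] i j supercomps_zero[OF L, of i]
      by (cases "j = 0") (auto simp: linked_parts_Inl_Inr[OF K] linked_parts_Inl_Inr[OF L])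
  qed
  \<comment> \<open>For \<open>m \<le> l\<close> the premise \<open>nf\<close> is vacuous. A
    fermionic block of \<open>K\<close> containing \<open>j\<close> would lie in the block of
    \<open>L\<close> with its own index, so that index would be \<open>l\<close>, which
    \<open>nf\<close> excludes.\<close>
  have block: "\<exists>k\<ge>m. k < length K \<and> j \<in> K ! k \<and> K ! k \<subseteq> L ! l"
    if l: "l < length L" and j: "j \<in> L ! l" "j \<noteq> 0" and nf: "l < m \<Longrightarrow> j \<notin> K ! l" for l j
  proof -
    have "j \<in> {1..n}" using supercomps_nth[OF L l] j by (auto simp: Suc_le_eq)
    then obtain k where k: "k < length K" "j \<in> K ! k" using supercomps_nth_ex[OF K] by blast
    have "m \<le> k"
    proof (rule ccontr)
      assume "\<not> m \<le> k"
      then have "j \<in> L ! k" "k < length L" using ferm[of k] k supercomps_length[OF L] by auto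
      then have "k = l" using supercomps_nth_unique[OF L _ l _ j] by blast
      with nf k \<open>\<not> m \<le> k\<close> show False by simp
    qed
    with k sub[OF k(1) _ l k(2) j] show ?thesis by blast
  qed
  show "sc_le m K L"
    unfolding sc_le_def
  proof (intro conjI allI impI ballI)
    fix i assume i: "i < m"
    then have il: "i < length L" using supercomps_length[OF L] by simp
    let ?J = "{B \<in> set (drop m K). B \<subseteq> L ! i}"
    have "L ! i \<subseteq> K ! i \<union> \<Union>?J"
    proof
      fix j assume j: "j \<in> L ! i"
      show "j \<in> K ! i \<union> \<Union>?J"
      proof (cases "j = 0 \<or> j \<in> K ! i")
        case True
        then show ?thesis using i supercomps_zero[OF K, of i] supercomps_length[OF K] by auto
      next
        case False
        then show ?thesis using block[OF il j] by (auto simp: set_drop_conv_nth)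
      qed
    qed
    then have "L ! i = K ! i \<union> \<Union>?J" using ferm[OF i] by blast
    then show "\<exists>J\<subseteq>set (drop m K). L ! i = K ! i \<union> \<Union>J"
      by (intro exI[of _ ?J] conjI) (rule Collect_restrict, assumption)
  next
    fix B assume "B \<in> set (drop m L)"
    then obtain l where l: "m \<le> l" "l < length L" "B = L ! l" by (auto simp: set_drop_conv_nth)
    let ?J = "{C \<in> set (drop m K). C \<subseteq> B}"
    have "B \<subseteq> \<Union>?J"
    proof
      fix j assume j: "j \<in> B"
      then have "j \<noteq> 0" using l supercomps_zero[OF L l(2)] by (intro notI) simp
      then show "j \<in> \<Union>?J" using block[OF l(2), of j] l j by (auto simp: set_drop_conv_nth)
    qed
    then have "B = \<Union>?J" by blast
    then show "\<exists>J\<subseteq>set (drop m K). B = \<Union>J"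
      by (intro exI[of _ ?J] conjI) (rule Collect_restrict, assumption)
  qed
qed

section \<open>Supercompositions from partitions and equivalence relations\<close>

text \<open>The fermionic blocks are listed by the names of their zeros and the others by increasing
  minimum; \<open>sep\<close> keeps a block from carrying two zeros. The poset is thereby identified
  with the partitions that separate the zeros, ordered by refinement.\<close>

lemma ex_supercomp_partition:
  assumes P: "partition_on (ground n m) P"
    and sep: "\<And>i j. linked P (Inl i) (Inl j) \<Longrightarrow> i = j"
  obtains K where "K \<in> supercomps n m" "parts m K = P"
proof -
  define F where "F i = insert 0 {j. linked P (Inl i) (Inr j)}" for i
  define G where "G = (\<lambda>X. Inr -` X) ` {X \<in> P. \<forall>i. Inl i \<notin> X}"
  have inground: "j \<in> {1..n}" if "Inr j \<in> X" "X \<in> P" for j X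
    using that P by (auto simp: partition_on_def ground_def)
  have "finite P"
    using P by (rule finite_elements[rotated]) (simp add: ground_def)
  then have "finite G" by (simp add: G_def)
  have G: "B \<noteq> {}" "B \<subseteq> {1..n}" "Inr ` B \<in> P" if B: "B \<in> G" for B
  proof -
    obtain X where X: "X \<in> P" "\<forall>i. Inl i \<notin> X" "B = Inr -` X" using B unfolding G_def by blast
    have "X = Inr ` B"
    proof (intro equalityI subsetI)
      fix x assume "x \<in> X"
      then show "x \<in> Inr ` B" using X by (cases x) auto
    qed (use X in auto)
    then show "Inr ` B \<in> P" using X by simp
    show "B \<noteq> {}" using \<open>X = Inr ` B\<close> X(1) P by (auto simp: partition_on_def)
    show "B \<subseteq> {1..n}" using X inground by blast
  qed
  have finG: "finite B" if "B \<in> G" for B using G(2)[OF that] finite_subset by blast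
  have "inj_on Min G"
  proof (rule inj_onI)
    fix B C assume BC: "B \<in> G" "C \<in> G" "Min B = Min C"
    have "Min B \<in> B" "Min C \<in> C" using BC(1,2) G(1) finG by (blast intro: Min_in)+
    then have "(Inr (Min B) :: nat + nat) \<in> Inr ` B" "(Inr (Min B) :: nat + nat) \<in> Inr ` C"
      using BC(3) by simp_all
    then have "(Inr ` B :: (nat + nat) set) = Inr ` C"
      by (rule partition_onD_unique[OF P G(3)[OF BC(1)] G(3)[OF BC(2)]])
    then show "B = C" by (simp add: inj_image_eq_iff)
  qed
  \<comment> \<open>Disjoint blocks have distinct minima, which is what sorting \<open>G\<close>
    strictly by \<open>Min\<close> requires.\<close>
  then interpret folding_insort_key "(\<le>)" "(<)" G Min
    by unfold_locales
  obtain Ns where Ns: "sorted_wrt (<) (map Min Ns)" "set Ns = G"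
    using finite_set_strict_sorted[OF subset_refl \<open>finite G\<close>] by blast
  have "distinct (map Min Ns)" using Ns(1) by (simp add: strict_sorted_iff)
  then have "distinct Ns" by (simp add: distinct_map)
  define K where "K = map F [0..<m] @ Ns"
  have len: "length K = m + length Ns" by (simp add: K_def)
  have nth: "K ! k = (if k < m then F k else Ns ! (k - m))" for k
    by (simp add: K_def nth_append)
  have NsG: "Ns ! (k - m) \<in> G" if "k < length K" "\<not> k < m" for k
    using that len Ns(2) by (metis add_diff_inverse_nat nat_add_left_cancel_less nth_mem)
  have zero: "0 \<in> K ! k \<longleftrightarrow> k < m" if "k < length K" for k
  proof (cases "k < m")
    case True
    then show ?thesis by (simp add: nth F_def)
  next
    case False
    then have "0 \<notin> K ! k" using G(2)[OF NsG[OF that False]] by (auto simp: nth)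
    with False show ?thesis by simp
  qed
  \<comment> \<open>\<open>padP\<close> and, further down, \<open>Ppad\<close> are the two
    inclusions of \<open>parts m K = P\<close>.\<close>
  have padP: "padded m K k \<in> P" if k: "k < length K" for k
  proof (cases "k < m")
    case True
    then have "Inl k \<in> ground n m" by (simp add: ground_def)
    then obtain X where X: "X \<in> P" "Inl k \<in> X" using P by (auto simp: partition_on_def)
    have "padded m K k = X"
    proof (rule set_eqI)
      fix x show "x \<in> padded m K k \<longleftrightarrow> x \<in> X"
      proof (cases x)
        case (Inl i)
        then show ?thesis using sep[of k i] True X by (auto simp: in_padded linked_def)
      next
        case (Inr j)
        have "linked P (Inl k) (Inr j) \<longleftrightarrow> Inr j \<in> X"
          using X partition_onD_unique[OF P] unfolding linked_def by blast
        then show ?thesis using inground[OF _ X(1), of j] True Inr by (auto simp: in_padded nth F_def)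
      qed
    qed
    with X show ?thesis by simp
  next
    case False
    then have "padded m K k = Inr ` (Ns ! (k - m))"
      using zero[OF k] by (simp add: padded_def nth)
    then show ?thesis using G(3) NsG[OF k False] by simp
  qed
  have padinj: "k = l"
    if kl: "k < length K" "l < length K" "padded m K k = padded m K l" for k l
  proof (cases "k < m \<or> l < m")
    case True
    then show ?thesis using kl(3) in_padded(1)[of k m K k] in_padded(1)[of l m K k]
        in_padded(1)[of k m K l] in_padded(1)[of l m K l] by metis
  next
    case False
    then have "Ns ! (k - m) = Ns ! (l - m)"
      using kl(3) zero[OF kl(1)] zero[OF kl(2)] by (simp add: padded_def nth inj_image_eq_iff)
    then show ?thesis using False kl len \<open>distinct Ns\<close> by (auto simp: nth_eq_iff_index_eq)
  qed
  have Ppad: "\<exists>k<length K. X = padded m K k" if X: "X \<in> P" for X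
  proof (cases "\<exists>i. Inl i \<in> X")
    case True
    then obtain i where i: "Inl i \<in> X" by blast
    then have "i < m" using X P by (auto simp: partition_on_def ground_def)
    then have "i < length K" "Inl i \<in> padded m K i" by (simp_all add: len in_padded)
    then show ?thesis using partition_onD_unique[OF P X padP i] by blast
  next
    case False
    then have "Inr -` X \<in> G" using X by (auto simp: G_def)
    then obtain a where a: "a < length Ns" "Ns ! a = Inr -` X"
      using Ns(2) by (metis in_set_conv_nth)
    have "X \<noteq> {}" using X P by (auto simp: partition_on_def)
    then obtain x where x: "x \<in> X" by blast
    then obtain j where j: "x = Inr j" using False by (cases x) auto
    have "m + a < length K" using a len by simp
    moreover have "x \<in> padded m K (m + a)"
      using a x j inground[of j X] X by (simp add: in_padded nth)
    ultimately show ?thesis using partition_onD_unique[OF P X padP x] by blast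
  qed
  have parts: "parts m K = P" using padP Ppad unfolding parts_def by blast
  have "K \<in> supercomps n m"
    unfolding supercomps_def
  proof (intro CollectI conjI)
    show "m \<le> length K" by (simp add: len)
    show "\<forall>B\<in>set K. B \<noteq> {} \<and> B \<subseteq> {0..n}"
    proof
      fix B assume "B \<in> set K"
      then consider i where "B = F i" | "B \<in> G" using Ns(2) by (auto simp: K_def)
      then show "B \<noteq> {} \<and> B \<subseteq> {0..n}"
        using G(1,2)[of B] inground by cases (fastforce simp: F_def linked_def)+
    qed
    show "(\<Union>B\<in>set K. B - {0}) = {1..n}"
    proof (intro equalityI subsetI)
      fix j assume "j \<in> (\<Union>B\<in>set K. B - {0})"
      then obtain k where "k < length K" "Inr j \<in> padded m K k"
        by (auto simp: in_set_conv_nth in_padded)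
      then show "j \<in> {1..n}" using inground padP by blast
    next
      fix j assume j: "j \<in> {1..n}"
      then have "Inr j \<in> \<Union>P" using P by (auto simp: partition_on_def ground_def)
      then obtain k where "k < length K" "Inr j \<in> padded m K k" using Ppad by blast
      then show "j \<in> (\<Union>B\<in>set K. B - {0})" by (auto simp: in_padded intro: nth_mem)
    qed
    show "\<forall>i<length K. \<forall>j<length K. i \<noteq> j \<longrightarrow> K ! i \<inter> K ! j \<subseteq> {0}"
    proof (intro allI impI subsetI, rule ccontr)
      fix i j x assume *: "i < length K" "j < length K" "i \<noteq> j" "x \<in> K ! i \<inter> K ! j" "x \<notin> {0}"
      then have "Inr x \<in> padded m K i" "Inr x \<in> padded m K j" by (auto simp: in_padded)
      then have "padded m K i = padded m K j" using partition_onD_unique[OF P padP padP] * by blast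
      with padinj * show False by blast
    qed
    show "\<forall>i<length K. 0 \<in> K ! i \<longleftrightarrow> i < m" using zero by blast
    show "sorted_wrt (\<lambda>A B. Min A < Min B) (drop m K)"
      using Ns(1) by (simp add: K_def sorted_wrt_map)
  qed
  with parts show ?thesis using that by blast
qed

lemma linked_quotient:
  assumes "equiv A r"
  shows "linked (A // r) x y \<longleftrightarrow> (x, y) \<in> r"
proof
  assume "linked (A // r) x y"
  then show "(x, y) \<in> r" unfolding linked_def
    using quotient_eq_iff[OF assms] by metis
next
  assume xy: "(x, y) \<in> r"
  then have "x \<in> A" using assms by (auto simp: equiv_def refl_on_def)
  then have "r `` {x} \<in> A // r" "x \<in> r `` {x}"
    using quotientI equiv_class_self[OF assms] by auto
  with xy show "linked (A // r) x y" by (auto simp: linked_def)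
qed

text \<open>The form in which supercompositions are constructed below: from the intersection of two
  relations for meets, and from equality of letters for word types.\<close>

lemma ex_supercomp_equiv:
  assumes "equiv (ground n m) r" "\<And>i j. (Inl i, Inl j) \<in> r \<Longrightarrow> i = j"
  obtains K where "K \<in> supercomps n m" "\<And>x y. linked (parts m K) x y \<longleftrightarrow> (x, y) \<in> r"
  using ex_supercomp_partition[OF partition_on_quotient[OF assms(1)]] linked_quotient[OF assms(1)] assms(2)
  by metis

section \<open>Meets and the least element\<close>

lemma ex_sc_meet:
  assumes K: "K \<in> supercomps n m" and L: "L \<in> supercomps n m"
  shows "\<exists>N\<in>supercomps n m. \<forall>x y.
    linked (parts m N) x y \<longleftrightarrow> linked (parts m K) x y \<and> linked (parts m L) x y"
proof -
  let ?r = "{(x, y). linked (parts m K) x y \<and> linked (parts m L) x y}"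
  have "equiv (ground n m) ?r"
  proof (intro equivI refl_onI symI transI)
    show "?r \<subseteq> ground n m \<times> ground n m"
      using linked_in_ground[OF partition_on_parts[OF K]] by blast
    show "(x, x) \<in> ?r" if "x \<in> ground n m" for x
      using that by (simp add: linked_refl[OF partition_on_parts[OF K]]
          linked_refl[OF partition_on_parts[OF L]])
    show "(y, x) \<in> ?r" if "(x, y) \<in> ?r" for x y
      using that by (simp add: linked_sym)
    show "(x, z) \<in> ?r" if "(x, y) \<in> ?r" "(y, z) \<in> ?r" for x y z
      using that linked_trans[OF partition_on_parts[OF K], of x y z]
        linked_trans[OF partition_on_parts[OF L], of x y z] by simp
  qed
  moreover have "i = j" if "(Inl i, Inl j) \<in> ?r" for i j
    using that by (simp add: linked_parts_Inl_Inl[OF K])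
  ultimately obtain N where "N \<in> supercomps n m"
    "\<And>x y. linked (parts m N) x y \<longleftrightarrow> (x, y) \<in> ?r"
    using ex_supercomp_equiv by blast
  then show ?thesis by auto
qed

text \<open>\<open>sc_meet\<close> is a definite description. The element whose relation is the
  intersection satisfies it, and antisymmetry makes it the only one.\<close>

lemma sc_meet_linked:
  assumes K: "K \<in> supercomps n m" and L: "L \<in> supercomps n m"
  shows "sc_meet n m K L \<in> supercomps n m"
    and "linked (parts m (sc_meet n m K L)) x y \<longleftrightarrow>
      linked (parts m K) x y \<and> linked (parts m L) x y"
proof -
  obtain N where N: "N \<in> supercomps n m"
    "\<And>x y. linked (parts m N) x y \<longleftrightarrow> linked (parts m K) x y \<and> linked (parts m L) x y"
    using ex_sc_meet[OF K L] by blast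
  let ?Q = "\<lambda>N. N \<in> supercomps n m \<and> sc_le m N K \<and> sc_le m N L \<and>
     (\<forall>N'\<in>supercomps n m. sc_le m N' K \<and> sc_le m N' L \<longrightarrow> sc_le m N' N)"
  have QN: "?Q N" using N K L by (auto simp: sc_le_iff_linked)
  have "sc_meet n m K L = N"
    unfolding sc_meet_def
  proof (rule the_equality[of ?Q, OF QN])
    show "N' = N" if "?Q N'" for N' using that QN sc_le_antisym[of N' n m N] by blast
  qed
  with N show "sc_meet n m K L \<in> supercomps n m"
    and "linked (parts m (sc_meet n m K L)) x y \<longleftrightarrow>
      linked (parts m K) x y \<and> linked (parts m L) x y" by auto
qed

lemma sc_le_meet_iff:
  assumes "K \<in> supercomps n m" "L \<in> supercomps n m" "N \<in> supercomps n m"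
  shows "sc_le m N (sc_meet n m K L) \<longleftrightarrow> sc_le m N K \<and> sc_le m N L"
  using assms by (auto simp: sc_le_iff_linked sc_meet_linked)

lemma sc_bot_nth: "k < m + n \<Longrightarrow> sc_bot n m ! k = (if k < m then {0} else {Suc (k - m)})"
  by (auto simp: sc_bot_def nth_append simp del: upt_Suc)

lemma length_sc_bot: "length (sc_bot n m) = m + n"
  by (simp add: sc_bot_def)

lemma sc_bot_supercomps: "sc_bot n m \<in> supercomps n m"
  unfolding supercomps_def
proof (intro CollectI conjI)
  show "m \<le> length (sc_bot n m)" by (simp add: length_sc_bot)
  show "\<forall>B\<in>set (sc_bot n m). B \<noteq> {} \<and> B \<subseteq> {0..n}"
    by (auto simp: sc_bot_def simp del: upt_Suc)
  show "(\<Union>B\<in>set (sc_bot n m). B - {0}) = {1..n}"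
    by (auto simp: sc_bot_def simp del: upt_Suc)
  show "\<forall>i<length (sc_bot n m). \<forall>j<length (sc_bot n m). i \<noteq> j \<longrightarrow> sc_bot n m ! i \<inter> sc_bot n m ! j \<subseteq> {0}"
    by (auto simp: length_sc_bot sc_bot_nth)
  show "\<forall>i<length (sc_bot n m). 0 \<in> sc_bot n m ! i \<longleftrightarrow> i < m"
    by (auto simp: length_sc_bot sc_bot_nth)
  show "sorted_wrt (\<lambda>A B. Min A < Min B) (drop m (sc_bot n m))"
    by (simp add: sc_bot_def sorted_wrt_map del: upt_Suc)
qed

lemma linked_sc_bot: "linked (parts m (sc_bot n m)) x y \<longleftrightarrow> x \<in> ground n m \<and> y = x"
proof
  assume l: "linked (parts m (sc_bot n m)) x y"
  then obtain k where "k < m + n" "x \<in> padded m (sc_bot n m) k" "y \<in> padded m (sc_bot n m) k"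
    by (auto simp: linked_def parts_def length_sc_bot)
  then have "y = x" by (auto simp: padded_def sc_bot_nth split: if_splits)
  with l show "x \<in> ground n m \<and> y = x"
    using linked_in_ground[OF partition_on_parts[OF sc_bot_supercomps]] by blast
qed (simp add: linked_refl[OF partition_on_parts[OF sc_bot_supercomps]])

lemma sc_bot_le: "K \<in> supercomps n m \<Longrightarrow> sc_le m (sc_bot n m) K"
  by (auto simp: sc_le_iff_linked[OF sc_bot_supercomps] linked_sc_bot linked_refl[OF partition_on_parts])

text \<open>Used to express that a meet is the least element as a condition on pairs of
  points.\<close>

lemma eq_sc_bot_iff:
  assumes "K \<in> supercomps n m"
  shows "K = sc_bot n m \<longleftrightarrow> (\<forall>x y. linked (parts m K) x y \<longrightarrow> x = y)"
proof
  assume *: "\<forall>x y. linked (parts m K) x y \<longrightarrow> x = y"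
  then have "sc_le m K (sc_bot n m)"
    using linked_in_ground[OF partition_on_parts[OF assms]]
    by (auto simp: sc_le_iff_linked[OF assms sc_bot_supercomps] linked_sc_bot)
  then show "K = sc_bot n m"
    using sc_le_antisym[OF assms sc_bot_supercomps] sc_bot_le[OF assms] by blast
qed (simp add: linked_sc_bot)

section \<open>The Moebius function\<close>

text \<open>The recursion for \<open>moebius\<close> with its top term moved to the left. When
  \<open>K\<close> is not below \<open>L\<close>, the interval is empty.\<close>

lemma sum_moebius_right:
  assumes "K \<in> supercomps n m" "L \<in> supercomps n m"
  shows "(\<Sum>N\<in>{N \<in> supercomps n m. sc_le m K N \<and> sc_le m N L}. moebius n m K N) =
    (if K = L then 1 else 0)"
proof (cases "sc_le m K L")
  case False
  then have "{N \<in> supercomps n m. sc_le m K N \<and> sc_le m N L} = {}"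
    using sc_le_trans by blast
  moreover have "K \<noteq> L" using False sc_le_refl by auto
  ultimately show ?thesis by (simp only: sum.empty if_False)
next
  case le: True
  let ?A = "{N \<in> supercomps n m. sc_le m K N \<and> sc_le m N L}"
  have "?A - {L} = {N \<in> supercomps n m. sc_le m K N \<and> sc_le m N L \<and> N \<noteq> L}" by auto
  moreover have "finite ?A" using finite_supercomps by simp
  moreover have "L \<in> ?A" using assms le sc_le_refl by blast
  ultimately have *: "(\<Sum>N\<in>?A. moebius n m K N) = moebius n m K L +
      (\<Sum>N\<in>{N \<in> supercomps n m. sc_le m K N \<and> sc_le m N L \<and> N \<noteq> L}. moebius n m K N)"
    by (simp add: sum.remove)
  show ?thesis
  proof (cases "K = L")
    case True
    have "{N \<in> supercomps n m. sc_le m K N \<and> sc_le m N L \<and> N \<noteq> L} = {}"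
      using True assms sc_le_antisym by blast
    moreover have "moebius n m K L = 1"
      by (subst moebius.simps) (use True assms in \<open>simp add: sc_le_refl\<close>)
    ultimately show ?thesis unfolding * using True by (simp only: sum.empty if_True add_0_right simp_thms)
  next
    case False
    have "moebius n m K L =
        - (\<Sum>N\<in>{N \<in> supercomps n m. sc_le m K N \<and> sc_le m N L \<and> N \<noteq> L}. moebius n m K N)"
      by (subst moebius.simps) (use False le assms in simp)
    then show ?thesis unfolding * using False by simp
  qed
qed

section \<open>Moebius inversion over down-sets\<close>

text \<open>The down-set sums form a unitriangular system: a strictly smaller element has a strictly
  smaller down-set, so by induction only the top terms remain to be compared.\<close>

lemma down_sum_inject:
  fixes f g :: "nat set list \<Rightarrow> 'a :: ab_group_add"
  assumes "\<And>L. L \<in> supercomps n m \<Longrightarrow>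
      (\<Sum>K\<in>{K \<in> supercomps n m. sc_le m K L}. f K) = (\<Sum>K\<in>{K \<in> supercomps n m. sc_le m K L}. g K)"
    and "L \<in> supercomps n m"
  shows "f L = g L"
  using assms(2)
proof (induction "card {K \<in> supercomps n m. sc_le m K L}" arbitrary: L rule: less_induct)
  case less
  let ?A = "\<lambda>L. {K \<in> supercomps n m. sc_le m K L}"
  have eq: "f K = g K" if K: "K \<in> ?A L - {L}" for K
  proof (rule less.hyps)
    have "?A K \<subset> ?A L"
      using K less.prems sc_le_antisym[of K n m L] sc_le_trans[of m _ K L] sc_le_refl[of m L] by blast
    then show "card (?A K) < card (?A L)" by (simp add: psubset_card_mono finite_supercomps)
  qed (use K in simp)
  have "L \<in> ?A L" using less.prems sc_le_refl by blast
  moreover have "finite (?A L)" using finite_supercomps by simp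
  ultimately have "f L + sum f (?A L - {L}) = g L + sum g (?A L - {L})"
    using assms(1)[OF less.prems] by (simp add: sum.remove)
  moreover have "sum f (?A L - {L}) = sum g (?A L - {L})" using eq by (rule sum.cong[OF refl])
  ultimately show ?case by simp
qed

text \<open>Both sides run over the pairs \<open>N\<close>, \<open>K\<close> with \<open>P N\<close>
  and \<open>N \<sqsubseteq> K \<sqsubseteq> L\<close>.\<close>

lemma sum_interval_swap:
  fixes f :: "nat set list \<Rightarrow> nat set list \<Rightarrow> 'a :: comm_monoid_add"
  shows "(\<Sum>K\<in>{K \<in> supercomps n m. sc_le m K L}. \<Sum>N\<in>{N \<in> supercomps n m. P N \<and> sc_le m N K}. f N K) =
    (\<Sum>N\<in>{N \<in> supercomps n m. P N}. \<Sum>K\<in>{K \<in> supercomps n m. sc_le m N K \<and> sc_le m K L}. f N K)"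
proof -
  let ?S = "supercomps n m"
  have "(\<Sum>K\<in>{K \<in> ?S. sc_le m K L}. \<Sum>N\<in>{N \<in> ?S. P N \<and> sc_le m N K}. f N K) =
      (\<Sum>K\<in>{K \<in> ?S. sc_le m K L}. \<Sum>N\<in>{N \<in> {N \<in> ?S. P N}. sc_le m N K}. f N K)"
    by (simp add: conj_assoc)
  also have "\<dots> = (\<Sum>N\<in>{N \<in> ?S. P N}. \<Sum>K\<in>{K \<in> {K \<in> ?S. sc_le m K L}. sc_le m N K}. f N K)"
    by (rule sum.swap_restrict) (simp_all add: finite_supercomps)
  also have "\<dots> = (\<Sum>N\<in>{N \<in> ?S. P N}. \<Sum>K\<in>{K \<in> ?S. sc_le m N K \<and> sc_le m K L}. f N K)"
    by (intro sum.cong refl) auto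
  finally show ?thesis .
qed

text \<open>The defining recursion fixes the first argument; here the second one is fixed. In the
  incidence algebra this says that the one-sided inverse of the zeta function is two-sided. As
  functions of \<open>L\<close>, both sides have at \<open>T\<close> the down-set sum 1 if
  \<open>N \<sqsubseteq> T\<close> and 0 otherwise.\<close>

lemma sum_moebius_left:
  assumes N: "N \<in> supercomps n m" and L: "L \<in> supercomps n m"
  shows "(\<Sum>K\<in>{K \<in> supercomps n m. sc_le m N K \<and> sc_le m K L}. moebius n m K L) =
    (if N = L then 1 else 0)"
proof (rule down_sum_inject[where n = n and m = m and L = L, OF _ L])
  let ?S = "supercomps n m"
  fix T assume T: "T \<in> ?S"
  have "(\<Sum>K\<in>{K \<in> ?S. sc_le m K T}. \<Sum>J\<in>{J \<in> ?S. sc_le m N J \<and> sc_le m J K}. moebius n m J K) =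
      (\<Sum>J\<in>{J \<in> ?S. sc_le m N J}. \<Sum>K\<in>{K \<in> ?S. sc_le m J K \<and> sc_le m K T}. moebius n m J K)"
    by (rule sum_interval_swap)
  also have "\<dots> = (\<Sum>J\<in>{J \<in> ?S. sc_le m N J}. if J = T then 1 else 0)"
    using T by (intro sum.cong refl) (simp add: sum_moebius_right)
  also have "\<dots> = (if sc_le m N T then 1 else 0)"
    using T finite_supercomps by (simp add: sum.delta)
  also have "\<dots> = (\<Sum>K\<in>{K \<in> ?S. sc_le m K T}. if N = K then 1 else 0)"
    using N finite_supercomps by simp
  finally show "(\<Sum>K\<in>{K \<in> ?S. sc_le m K T}. \<Sum>J\<in>{J \<in> ?S. sc_le m N J \<and> sc_le m J K}. moebius n m J K) =
      (\<Sum>K\<in>{K \<in> ?S. sc_le m K T}. if N = K then 1 else 0)" .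
qed

text \<open>As a function of \<open>K\<close>, the inner sum is the down-set sum of \<open>F\<close>
  set to zero at all \<open>N\<close> not below \<open>T\<close>. Inversion returns this truncated
  function at \<open>L\<close>.\<close>

lemma sum_moebius_down_sum:
  fixes F :: "nat set list \<Rightarrow> 'a :: comm_ring_1"
  assumes L: "L \<in> supercomps n m"
  shows "(\<Sum>K\<in>{K \<in> supercomps n m. sc_le m K L}. of_int (moebius n m K L) *
      (\<Sum>N\<in>{N \<in> supercomps n m. sc_le m N T \<and> sc_le m N K}. F N)) = (if sc_le m L T then F L else 0)"
proof -
  let ?S = "supercomps n m"
  have "(\<Sum>K\<in>{K \<in> ?S. sc_le m K L}. of_int (moebius n m K L) *
      (\<Sum>N\<in>{N \<in> ?S. sc_le m N T \<and> sc_le m N K}. F N)) =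
    (\<Sum>N\<in>{N \<in> ?S. sc_le m N T}. \<Sum>K\<in>{K \<in> ?S. sc_le m N K \<and> sc_le m K L}. of_int (moebius n m K L) * F N)"
    unfolding sum_distrib_left by (rule sum_interval_swap)
  also have "\<dots> = (\<Sum>N\<in>{N \<in> ?S. sc_le m N T}. if N = L then F N else 0)"
  proof (rule sum.cong[OF refl])
    fix N assume "N \<in> {N \<in> ?S. sc_le m N T}"
    then have N: "N \<in> ?S" by simp
    have "(\<Sum>K\<in>{K \<in> ?S. sc_le m N K \<and> sc_le m K L}. of_int (moebius n m K L) * F N) =
        of_int (if N = L then 1 else 0) * F N"
      unfolding sum_moebius_left[OF N L, symmetric] by (simp add: sum_distrib_right)
    then show "(\<Sum>K\<in>{K \<in> ?S. sc_le m N K \<and> sc_le m K L}. of_int (moebius n m K L) * F N) =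
        (if N = L then F N else 0)" by simp
  qed
  also have "\<dots> = (if sc_le m L T then F L else 0)"
    using L finite_supercomps by (simp add: sum.delta')
  finally show ?thesis .
qed

section \<open>Cycle weights and the Moebius function from the least element\<close>

text \<open>At \<open>x = 1\<close> this is the number of permutations whose cycles are the parts of
  \<open>K\<close>. At \<open>x = -1\<close> it is, up to a sign depending only on \<open>n\<close>
  and \<open>m\<close>, the Moebius function from the least element to \<open>K\<close>.\<close>

definition cycle_weight :: "nat \<Rightarrow> rat \<Rightarrow> nat set list \<Rightarrow> rat" where
  "cycle_weight m x K = (\<Prod>B\<in>parts m K. x * fact (card B - 1))"

lemma finite_parts: "finite (parts m K)"
  by (simp add: parts_def)

lemma finite_ground: "finite (ground n m)"
  by (simp add: ground_def)

lemma finite_in_parts: "K \<in> supercomps n m \<Longrightarrow> B \<in> parts m K \<Longrightarrow> finite B \<and> B \<noteq> {}"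
  using partition_on_parts[of K n m] finite_subset[OF _ finite_ground[of n m], of B]
  by (auto simp: partition_on_def)

text \<open>Colouring each point by its block in \<open>L\<close> makes the monochromatic partitions
  exactly the refinements of \<open>L\<close>. These separate the zeros because \<open>L\<close>
  does, so each comes from a supercomposition.\<close>

lemma sum_cycle_weight:
  assumes L: "L \<in> supercomps n m"
  shows "(\<Sum>K\<in>{K \<in> supercomps n m. sc_le m K L}. cycle_weight m x K) =
    (\<Prod>B\<in>parts m L. pochhammer x (card B))"
proof -
  let ?A = "ground n m"
  \<comment> \<open>On the ground set the colour of \<open>y\<close> is its block in
    \<open>L\<close>; the description by \<open>linked\<close> avoids a choice.\<close>
  define c where "c y = {z. linked (parts m L) y z}" for y
  note pL = partition_on_parts[OF L]
  have c_block: "c y = B" if "B \<in> parts m L" "y \<in> B" for y B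
    using that partition_onD_unique[OF pL] unfolding c_def linked_def by blast
  have c_eq: "c y = c z \<longleftrightarrow> linked (parts m L) y z" if "y \<in> ?A" "z \<in> ?A" for y z
  proof
    assume "c y = c z"
    moreover have "z \<in> c z" using that linked_refl[OF pL] by (simp add: c_def)
    ultimately show "linked (parts m L) y z" unfolding c_def by blast
  next
    assume "linked (parts m L) y z"
    then show "c y = c z" unfolding linked_def using c_block by blast
  qed
  have cA: "c ` ?A \<subseteq> parts m L"
  proof
    fix B assume "B \<in> c ` ?A"
    then obtain y where y: "y \<in> ?A" "B = c y" by blast
    then obtain C where "C \<in> parts m L" "y \<in> C" using pL by (auto simp: partition_on_def)
    with c_block y show "B \<in> parts m L" by metis
  qed
  have fiber: "{y \<in> ?A. c y = B} = B" if B: "B \<in> parts m L" for B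
  proof (intro equalityI subsetI)
    fix y assume "y \<in> {y \<in> ?A. c y = B}"
    then show "y \<in> B" using linked_refl[OF pL] by (auto simp: c_def)
  next
    fix y assume "y \<in> B"
    then show "y \<in> {y \<in> ?A. c y = B}" using c_block[OF B] B pL by (auto simp: partition_on_def)
  qed
  have mono: "P \<in> mono_partitions c ?A \<longleftrightarrow>
      partition_on ?A P \<and> (\<forall>x y. linked P x y \<longrightarrow> linked (parts m L) x y)" for P
  proof -
    have "(\<forall>B\<in>P. \<forall>x\<in>B. \<forall>y\<in>B. c x = c y) \<longleftrightarrow> (\<forall>x y. linked P x y \<longrightarrow> linked (parts m L) x y)"
      if P: "partition_on ?A P"
    proof -
      have "(\<forall>B\<in>P. \<forall>x\<in>B. \<forall>y\<in>B. c x = c y) \<longleftrightarrow> (\<forall>x y. linked P x y \<longrightarrow> c x = c y)"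
        unfolding linked_def by blast
      then show ?thesis using c_eq linked_in_ground[OF P] by metis
    qed
    then show ?thesis unfolding mono_partitions_def by blast
  qed
  have "bij_betw (parts m) {K \<in> supercomps n m. sc_le m K L} (mono_partitions c ?A)"
    unfolding bij_betw_def
  proof (intro conjI inj_onI equalityI subsetI)
    fix K K' assume *: "K \<in> {K \<in> supercomps n m. sc_le m K L}" "K' \<in> {K \<in> supercomps n m. sc_le m K L}"
      "parts m K = parts m K'"
    then have "sc_le m K K'" "sc_le m K' K" by (auto simp: sc_le_iff_linked)
    with * show "K = K'" using sc_le_antisym by blast
  next
    fix P assume "P \<in> parts m ` {K \<in> supercomps n m. sc_le m K L}"
    then show "P \<in> mono_partitions c ?A"
      using L unfolding mono by (auto simp: sc_le_iff_linked intro: partition_on_parts)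
  next
    fix P assume "P \<in> mono_partitions c ?A"
    then have P: "partition_on ?A P" "\<And>x y. linked P x y \<Longrightarrow> linked (parts m L) x y"
      unfolding mono by blast+
    have sep: "i = j" if "linked P (Inl i) (Inl j)" for i j
      using P(2)[OF that] by (simp add: linked_parts_Inl_Inl[OF L])
    obtain K where K: "K \<in> supercomps n m" "parts m K = P"
      by (rule ex_supercomp_partition[OF P(1) sep])
    then have "sc_le m K L" using P(2) L by (simp add: sc_le_iff_linked)
    with K show "P \<in> parts m ` {K \<in> supercomps n m. sc_le m K L}" by blast
  qed
  then have "(\<Sum>K\<in>{K \<in> supercomps n m. sc_le m K L}. cycle_weight m x K) =
      (\<Sum>P\<in>mono_partitions c ?A. \<Prod>B\<in>P. x * fact (card B - 1))"
    unfolding cycle_weight_def by (rule sum.reindex_bij_betw)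
  also have "\<dots> = (\<Prod>B\<in>parts m L. pochhammer x (card {y \<in> ?A. c y = B}))"
    by (rule sum_prod_fact_mono_partitions[OF finite_ground finite_parts cA])
  also have "\<dots> = (\<Prod>B\<in>parts m L. pochhammer x (card B))"
    by (intro prod.cong refl) (simp add: fiber)
  finally show ?thesis .
qed

text \<open>The permutations preserving every block of \<open>L\<close> are counted according to
  their cycle partitions.\<close>

lemma sum_cycle_weight_1:
  assumes "L \<in> supercomps n m"
  shows "(\<Sum>K\<in>{K \<in> supercomps n m. sc_le m K L}. cycle_weight m 1 K) = of_nat (sc_fact L)"
proof -
  have "(\<Prod>B\<in>parts m L. pochhammer (1 :: rat) (card B)) = of_nat (\<Prod>B\<in>parts m L. fact (card B))"
    by (simp add: pochhammer_fact[symmetric])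
  then show ?thesis
    unfolding sum_cycle_weight[OF assms] sc_fact_def prod_parts[OF assms] by simp
qed

text \<open>The rising factorial of -1 begins with the factors -1 and 0.\<close>

lemma pochhammer_minus_1: "pochhammer (-1 :: 'a :: comm_ring_1) (Suc (Suc k)) = 0"
  by (simp add: pochhammer_rec)

text \<open>A block with at least two points makes its factor vanish. At the least element all
  blocks are singletons, and each contributes -1.\<close>

lemma sum_cycle_weight_minus_1:
  assumes L: "L \<in> supercomps n m"
  shows "(\<Sum>K\<in>{K \<in> supercomps n m. sc_le m K L}. cycle_weight m (-1) K) =
    (if L = sc_bot n m then (-1) ^ card (parts m (sc_bot n m)) else 0)"
  unfolding sum_cycle_weight[OF L]
proof (cases "L = sc_bot n m")
  case True
  have "card B = 1" if B: "B \<in> parts m L" for B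
  proof -
    obtain x where x: "x \<in> B" using finite_in_parts[OF L B] by blast
    have "y = x" if "y \<in> B" for y
      using x that B linked_sc_bot[of m n x y] True unfolding linked_def by blast
    with x have "B = {x}" by blast
    then show ?thesis by simp
  qed
  then show "(\<Prod>B\<in>parts m L. pochhammer (- 1 :: rat) (card B)) =
      (if L = sc_bot n m then (-1) ^ card (parts m (sc_bot n m)) else 0)"
    using True by simp
next
  case False
  then obtain x y where "linked (parts m L) x y" "x \<noteq> y" using eq_sc_bot_iff[OF L] by blast
  then obtain B where B: "B \<in> parts m L" "{x, y} \<subseteq> B" by (auto simp: linked_def)
  then have "card {x, y} \<le> card B" using finite_in_parts[OF L B(1)] by (intro card_mono) auto
  then have "2 \<le> card B" using \<open>x \<noteq> y\<close> by simp
  then have "pochhammer (-1 :: rat) (card B) = 0"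
    by (metis add_2_eq_Suc le_Suc_ex pochhammer_minus_1)
  then have "(\<Prod>B\<in>parts m L. pochhammer (- 1 :: rat) (card B)) = 0"
    using B(1) finite_parts by (auto simp: prod_zero_iff)
  then show "(\<Prod>B\<in>parts m L. pochhammer (- 1 :: rat) (card B)) =
      (if L = sc_bot n m then (-1) ^ card (parts m (sc_bot n m)) else 0)"
    using False by simp
qed

text \<open>Both sides have the down-set sum 1 at the least element and 0 elsewhere, hence agree;
  the power of -1 normalises the cycle weights accordingly.\<close>

lemma moebius_sc_bot:
  assumes L: "L \<in> supercomps n m"
  shows "of_int (moebius n m (sc_bot n m) L) =
    (-1) ^ card (parts m (sc_bot n m)) * cycle_weight m (-1) L"
proof (rule down_sum_inject[OF _ L])
  fix T assume T: "T \<in> supercomps n m"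
  have "{K \<in> supercomps n m. sc_le m K T} = {K \<in> supercomps n m. sc_le m (sc_bot n m) K \<and> sc_le m K T}"
    using sc_bot_le by blast
  then have "(\<Sum>K\<in>{K \<in> supercomps n m. sc_le m K T}. of_int (moebius n m (sc_bot n m) K)) =
      (of_int (if sc_bot n m = T then 1 else 0) :: rat)"
    by (simp only: of_int_sum[symmetric] sum_moebius_right[OF sc_bot_supercomps T])
  also have "\<dots> = (\<Sum>K\<in>{K \<in> supercomps n m. sc_le m K T}.
      (-1) ^ card (parts m (sc_bot n m)) * cycle_weight m (-1) K)"
    by (simp add: sum_distrib_left[symmetric] sum_cycle_weight_minus_1[OF T] power_mult_distrib[symmetric])
  finally show "(\<Sum>K\<in>{K \<in> supercomps n m. sc_le m K T}. of_int (moebius n m (sc_bot n m) K)) =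
      (\<Sum>K\<in>{K \<in> supercomps n m. sc_le m K T}.
      (-1) ^ card (parts m (sc_bot n m)) * cycle_weight m (-1) K)" .
qed

lemma abs_moebius_sc_bot:
  assumes "L \<in> supercomps n m"
  shows "of_int \<bar>moebius n m (sc_bot n m) L\<bar> = cycle_weight m 1 L"
  by (simp add: moebius_sc_bot[OF assms] of_int_abs abs_mult power_abs cycle_weight_def abs_prod)

lemma cycle_weight_1_pos: "cycle_weight m 1 L > 0"
  unfolding cycle_weight_def by (rule prod_pos) simp

text \<open>Needed to cancel the denominators in the second and third expansions, since division by
  zero would yield 0.\<close>

lemma moebius_sc_bot_nonzero:
  assumes "L \<in> supercomps n m"
  shows "moebius n m (sc_bot n m) L \<noteq> 0"
  using abs_moebius_sc_bot[OF assms] cycle_weight_1_pos[of m L] by auto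

section \<open>Coefficients\<close>

text \<open>A word is read as a labelling of the ground set; the type of a word with distinct
  \<theta>-letters is the partition into level sets.\<close>

fun letter :: "sword \<Rightarrow> nat + nat \<Rightarrow> nat" where
  "letter (a, b) (Inl i) = a ! i"
| "letter (a, b) (Inr j) = b ! (j - 1)"

lemma ball_ground: "(\<forall>x\<in>ground n m. P x) \<longleftrightarrow> (\<forall>i<m. P (Inl i)) \<and> (\<forall>j\<in>{1..n}. P (Inr j))"
  by (auto simp: ground_def)

text \<open>\<open>M_words\<close> says nothing about pairs of \<theta>-letters. Different zeros are
  never linked, and distinctness of \<open>a\<close> makes the equivalence hold for these pairs
  too.\<close>

lemma M_words_iff_linked:
  assumes K: "K \<in> supercomps n m" and u: "(a, b) \<in> words n m" "distinct a"
  shows "(a, b) \<in> M_words n m K \<longleftrightarrow> (\<forall>x\<in>ground n m. \<forall>y\<in>ground n m.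
    linked (parts m K) x y \<longleftrightarrow> letter (a, b) x = letter (a, b) y)"
proof -
  define E where "E x y \<longleftrightarrow> (linked (parts m K) x y \<longleftrightarrow> letter (a, b) x = letter (a, b) y)" for x y
  have sym: "E x y \<Longrightarrow> E y x" for x y
    unfolding E_def by (metis linked_sym)
  have inl: "E (Inl i) (Inl j)" if "i < m" "j < m" for i j
    unfolding E_def using u that by (auto simp: linked_parts_Inl_Inl[OF K] words_def nth_eq_iff_index_eq)
  have "(a, b) \<in> M_words n m K \<longleftrightarrow> (\<forall>i<m. \<forall>j\<in>{1..n}. E (Inl i) (Inr j)) \<and>
      (\<forall>i\<in>{1..n}. \<forall>j\<in>{1..n}. E (Inr i) (Inr j))"
    using u(1) unfolding M_words_def E_def linked_parts_Inl_Inr[OF K] linked_parts_Inr_Inr[OF K]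
    by (simp add: eq_commute[of "_ \<in> _"] eq_commute[of "same_block _ _ _"])
  also have "\<dots> \<longleftrightarrow> (\<forall>x\<in>ground n m. \<forall>y\<in>ground n m. E x y)"
    unfolding ball_ground using sym inl by blast
  finally show ?thesis unfolding E_def .
qed

text \<open>Equality of letters is an equivalence relation on the ground set, and distinct
  \<theta>-letters keep the zeros apart. So a type exists, and it is unique because its relation
  determines it.\<close>

lemma word_type_linked:
  assumes u: "(a, b) \<in> words n m" "distinct a"
  shows "word_type n m (a, b) \<in> supercomps n m"
    and "linked (parts m (word_type n m (a, b))) x y \<longleftrightarrow>
      x \<in> ground n m \<and> y \<in> ground n m \<and> letter (a, b) x = letter (a, b) y"
proof -
  let ?r = "{(x, y). x \<in> ground n m \<and> y \<in> ground n m \<and> letter (a, b) x = letter (a, b) y}"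
  have equiv: "equiv (ground n m) ?r"
    by (auto intro!: equivI refl_onI symI transI)
  have sep: "i = j" if "(Inl i, Inl j) \<in> ?r" for i j
    using that u by (auto simp: ground_def words_def nth_eq_iff_index_eq)
  obtain L where L: "L \<in> supercomps n m" "\<And>x y. linked (parts m L) x y \<longleftrightarrow> (x, y) \<in> ?r"
    using ex_supercomp_equiv[OF equiv sep] by blast
  have "(a, b) \<in> M_words n m L"
    unfolding M_words_iff_linked[OF L(1) u] using L(2) by simp
  moreover have "K = L" if "K \<in> supercomps n m" "(a, b) \<in> M_words n m K" for K
  proof -
    have "linked (parts m K) x y \<longleftrightarrow> linked (parts m L) x y" for x y
      using that(2)[unfolded M_words_iff_linked[OF that(1) u]] L(2)
        linked_in_ground[OF partition_on_parts[OF that(1)], of x y] by auto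
    then show ?thesis
      using that(1) L(1) by (intro sc_le_antisym) (auto simp: sc_le_iff_linked)
  qed
  ultimately have "word_type n m (a, b) = L"
    unfolding word_type_def using L(1) by (intro the_equality) blast+
  with L show "word_type n m (a, b) \<in> supercomps n m"
    and "linked (parts m (word_type n m (a, b))) x y \<longleftrightarrow>
      x \<in> ground n m \<and> y \<in> ground n m \<and> letter (a, b) x = letter (a, b) y" by simp_all
qed

context
  fixes n m :: nat and a b :: "nat list" and K :: "nat set list"
  assumes K: "K \<in> supercomps n m" and u: "(a, b) \<in> words n m" "distinct a"
begin

lemma M_words_iff: "(a, b) \<in> M_words n m K \<longleftrightarrow> word_type n m (a, b) = K"
proof
  assume "(a, b) \<in> M_words n m K"
  then have "linked (parts m K) x y \<longleftrightarrow> linked (parts m (word_type n m (a, b))) x y" for x y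
    unfolding M_words_iff_linked[OF K u] word_type_linked[OF u]
    using linked_in_ground[OF partition_on_parts[OF K], of x y] by auto
  then show "word_type n m (a, b) = K"
    using K word_type_linked(1)[OF u] by (intro sc_le_antisym) (auto simp: sc_le_iff_linked)
next
  assume "word_type n m (a, b) = K"
  then show "(a, b) \<in> M_words n m K"
    unfolding M_words_iff_linked[OF K u] using word_type_linked(2)[OF u] by simp
qed

text \<open>Linked points are a zero and an element, two elements, or a zero and itself. Symmetry
  and reflexivity of \<open>R\<close> leave just the two kinds of conditions that occur in
  \<open>p_fun\<close> and \<open>e_fun\<close>.\<close>

lemma linked_ball_iff:
  assumes "\<And>x y. R x y \<longleftrightarrow> R y x" and "\<And>x. R x x"
  shows "(\<forall>x y. linked (parts m K) x y \<longrightarrow> R x y) \<longleftrightarrow>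
    (\<forall>i<m. \<forall>j\<in>K ! i - {0}. R (Inl i) (Inr j)) \<and>
    (\<forall>i\<in>{1..n}. \<forall>j\<in>{1..n}. same_block K i j \<longrightarrow> R (Inr i) (Inr j))" (is "?l \<longleftrightarrow> ?r")
proof
  assume ?l
  then show ?r by (simp add: linked_parts_Inl_Inr[OF K] linked_parts_Inr_Inr[OF K])
next
  assume r: ?r
  show ?l
  proof (intro allI impI)
    fix x y assume l: "linked (parts m K) x y"
    then have l': "linked (parts m K) y x" by (rule linked_sym)
    show "R x y"
    proof (cases x; cases y)
      fix i j assume "x = Inl i" "y = Inl j"
      then show ?thesis using l assms(2) by (simp add: linked_parts_Inl_Inl[OF K])
    next
      fix i j assume "x = Inl i" "y = Inr j"
      then show ?thesis using l r by (simp add: linked_parts_Inl_Inr[OF K])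
    next
      fix i j assume "x = Inr i" "y = Inl j"
      then show ?thesis using l' r assms(1) by (simp add: linked_parts_Inl_Inr[OF K])
    next
      fix i j assume "x = Inr i" "y = Inr j"
      then show ?thesis using l r by (simp add: linked_parts_Inr_Inr[OF K])
    qed
  qed
qed

lemma p_condition_iff:
  "(\<forall>i<m. \<forall>j\<in>K ! i - {0}. a ! i = b ! (j - 1)) \<and>
   (\<forall>i\<in>{1..n}. \<forall>j\<in>{1..n}. same_block K i j \<longrightarrow> b ! (i - 1) = b ! (j - 1)) \<longleftrightarrow>
   sc_le m K (word_type n m (a, b))"
proof -
  have "sc_le m K (word_type n m (a, b)) \<longleftrightarrow>
      (\<forall>x y. linked (parts m K) x y \<longrightarrow> letter (a, b) x = letter (a, b) y)"
    unfolding sc_le_iff_linked[OF K word_type_linked(1)[OF u]] word_type_linked(2)[OF u]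
    using linked_in_ground[OF partition_on_parts[OF K]] by blast
  also have "\<dots> \<longleftrightarrow> (\<forall>i<m. \<forall>j\<in>K ! i - {0}. letter (a, b) (Inl i) = letter (a, b) (Inr j)) \<and>
    (\<forall>i\<in>{1..n}. \<forall>j\<in>{1..n}. same_block K i j \<longrightarrow> letter (a, b) (Inr i) = letter (a, b) (Inr j))"
    by (rule linked_ball_iff) auto
  finally show ?thesis by simp
qed

lemma e_condition_iff:
  "(\<forall>i<m. \<forall>j\<in>K ! i - {0}. a ! i \<noteq> b ! (j - 1)) \<and>
   (\<forall>i\<in>{1..n}. \<forall>j\<in>{1..n}. i \<noteq> j \<and> same_block K i j \<longrightarrow> b ! (i - 1) \<noteq> b ! (j - 1)) \<longleftrightarrow>
   sc_meet n m K (word_type n m (a, b)) = sc_bot n m"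
proof -
  have "sc_meet n m K (word_type n m (a, b)) = sc_bot n m \<longleftrightarrow>
      (\<forall>x y. linked (parts m K) x y \<longrightarrow> letter (a, b) x = letter (a, b) y \<longrightarrow> x = y)"
    unfolding eq_sc_bot_iff[OF sc_meet_linked(1)[OF K word_type_linked(1)[OF u]]]
      sc_meet_linked(2)[OF K word_type_linked(1)[OF u]] word_type_linked(2)[OF u]
    using linked_in_ground[OF partition_on_parts[OF K]] by blast
  \<comment> \<open>The relation \<open>R\<close> is here that equal letters force equal points. As
    \<open>Inl i\<close> and \<open>Inr j\<close> always differ, it amounts to different letters for
    such pairs.\<close>
  also have "\<dots> \<longleftrightarrow> (\<forall>i<m. \<forall>j\<in>K ! i - {0}.
      letter (a, b) (Inl i) = letter (a, b) (Inr j) \<longrightarrow> (Inl i :: nat + nat) = Inr j) \<and>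
    (\<forall>i\<in>{1..n}. \<forall>j\<in>{1..n}. same_block K i j \<longrightarrow>
      letter (a, b) (Inr i) = letter (a, b) (Inr j) \<longrightarrow> (Inr i :: nat + nat) = Inr j)"
    by (rule linked_ball_iff) auto
  finally show ?thesis by auto
qed

text \<open>
  The words excluded from \<open>h_fun\<close> have at least two \<open>\<theta>\<close>-letters that do not occur among the
  \<open>x\<close>-letters; such words have no type above a composition with at most one block \<open>{0}\<close>.
\<close>

lemma h_condition:
  assumes le: "sc_le m K (word_type n m (a, b))"
    and one: "\<And>i j. i < j \<Longrightarrow> j < m \<Longrightarrow> K ! i \<noteq> {0} \<or> K ! j \<noteq> {0}"
  shows "card (set a - set b) \<le> 1"
proof (rule ccontr)
  assume "\<not> card (set a - set b) \<le> 1"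
  then obtain v w where vw: "v \<in> set a - set b" "w \<in> set a - set b" "v \<noteq> w"
    using card_le_Suc0_iff_eq[of "set a - set b"] unfolding One_nat_def by blast
  have len: "length a = m" "length b = n" using u by (auto simp: words_def)
  \<comment> \<open>Since \<open>K\<close> lies below the type, a nonzero element of
    \<open>K ! i\<close> would give an \<open>x\<close>-letter equal to
    \<open>a ! i\<close>.\<close>
  have zero: "K ! i = {0}" if i: "i < m" "a ! i \<notin> set b" for i
  proof -
    have il: "i < length K" using i supercomps_length[OF K] by simp
    have "j = 0" if j: "j \<in> K ! i" for j
    proof (rule ccontr)
      assume "j \<noteq> 0"
      then have "a ! i = b ! (j - 1)" using p_condition_iff le i j by blast
      moreover have "j - 1 < length b"
        using supercomps_nth[OF K il] j \<open>j \<noteq> 0\<close> len by fastforce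
      ultimately show False using i nth_mem by metis
    qed
    then show ?thesis using supercomps_nth[OF K il] by blast
  qed
  obtain i j where ij: "i < m" "j < m" "a ! i = v" "a ! j = w"
    using vw len by (metis DiffD1 in_set_conv_nth)
  then have "K ! i = {0}" "K ! j = {0}" "i \<noteq> j" using zero vw by auto
  then show False using one[of i j] one[of j i] ij by (meson nat_neq_iff)
qed

end

section \<open>Coefficients as finite sums over words\<close>

lemma coeff_sum_scaleQ: "coeff (\<Sum>K\<in>A. scaleQ (d K) (f K)) S w = (\<Sum>K\<in>A. d K * coeff (f K) S w)"
  by (induction A rule: infinite_finite_induct)
     (simp_all add: zero_sseries.rep_eq plus_sseries.rep_eq scaleQ.rep_eq)

text \<open>Words with a repeated \<theta>-letter vanish, so only these finitely many words can
  contribute to the coefficient at \<open>S\<close> and \<open>w\<close>. One index set serves all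
  four families of functions.\<close>

definition monomial_words :: "nat \<Rightarrow> nat \<Rightarrow> nat set \<Rightarrow> nat list \<Rightarrow> sword set" where
  "monomial_words n m S w = {(a, b) \<in> words n m. distinct a \<and> set a = S \<and> b = w}"

lemma finite_monomial_words: "finite (monomial_words n m S w)"
proof -
  have "finite {a. set a = S \<and> distinct a}"
    by (cases "finite S") (auto intro: finite_subset[OF _ finite_subset_distinct])
  then show ?thesis
    by (rule finite_subset[rotated, OF finite_cartesian_product, of _ "{w}"])
       (auto simp: monomial_words_def)
qed

lemma coeff_formal_sum:
  assumes "U \<subseteq> words n m"
  shows "coeff (formal_sum (\<lambda>u. scaleQ (c u) (word_val u)) U) S w =
    (\<Sum>u\<in>monomial_words n m S w. (if u \<in> U then c u else 0) * coeff (word_val u) S w)"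
  unfolding coeff_formal_sum_words[OF assms]
proof (rule sum.mono_neutral_cong_left)
  show "{u \<in> U. coeff (scaleQ (c u) (word_val u)) S w \<noteq> 0} \<subseteq> monomial_words n m S w"
    using assms by (auto simp: monomial_words_def scaleQ.rep_eq dest: coeff_word_val_nonzero)
qed (auto simp: finite_monomial_words scaleQ.rep_eq)

lemma coeff_formal_sum_1:
  assumes "U \<subseteq> words n m"
  shows "coeff (formal_sum word_val U) S w =
    (\<Sum>u\<in>monomial_words n m S w. (if u \<in> U then 1 else 0) * coeff (word_val u) S w)"
proof -
  have "word_val = (\<lambda>u. scaleQ 1 (word_val u))"
    by (auto intro!: sseries_eqI simp: scaleQ.rep_eq)
  then show ?thesis using coeff_formal_sum[OF assms, of "\<lambda>_. 1"] by simp
qed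

lemma coeff_m_fun:
  assumes "K \<in> supercomps n m"
  shows "coeff (m_fun n m K) S w = (\<Sum>u\<in>monomial_words n m S w.
    (if word_type n m u = K then 1 else 0) * coeff (word_val u) S w)"
proof -
  have sub: "M_words n m K \<subseteq> words n m" by (auto simp: M_words_def)
  have iff: "u \<in> M_words n m K \<longleftrightarrow> word_type n m u = K" if "u \<in> monomial_words n m S w" for u
    using that by (cases u) (simp add: monomial_words_def M_words_iff[OF assms])
  show ?thesis
    unfolding m_fun_def coeff_formal_sum_1[OF sub] by (rule sum.cong[OF refl]) (simp only: iff)
qed

lemma coeff_p_fun:
  assumes "K \<in> supercomps n m"
  shows "coeff (p_fun n m K) S w = (\<Sum>u\<in>monomial_words n m S w.
    (if sc_le m K (word_type n m u) then 1 else 0) * coeff (word_val u) S w)"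
  unfolding p_fun_def
  by (subst coeff_formal_sum_1[of _ n m])
     (auto simp: monomial_words_def p_condition_iff[OF assms, symmetric] intro!: sum.cong)

lemma coeff_e_fun:
  assumes "K \<in> supercomps n m"
  shows "coeff (e_fun n m K) S w = (\<Sum>u\<in>monomial_words n m S w.
    (if sc_meet n m K (word_type n m u) = sc_bot n m then 1 else 0) * coeff (word_val u) S w)"
  unfolding e_fun_def
  by (subst coeff_formal_sum_1[of _ n m])
     (auto simp: monomial_words_def e_condition_iff[OF assms, symmetric] intro!: sum.cong)

lemma coeff_h_fun:
  "coeff (h_fun n m K) S w = (\<Sum>u\<in>monomial_words n m S w.
    (if card (set (fst u) - set (snd u)) \<le> 1
     then of_nat (sc_fact (sc_meet n m K (word_type n m u))) else 0) * coeff (word_val u) S w)"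
  unfolding h_fun_def
  by (subst coeff_formal_sum[of _ n m]) (auto simp: monomial_words_def intro!: sum.cong)

lemma monomial_words_type:
  assumes "u \<in> monomial_words n m S w"
  shows "word_type n m u \<in> supercomps n m"
  using assms word_type_linked(1) by (auto simp: monomial_words_def)

text \<open>Reduces identities of series to identities of weights: \<open>g K u\<close> is the
  weight of the word \<open>u\<close> in \<open>f K\<close>, and the coefficient \<open>v u\<close>
  of the word itself, sign included, is a common factor.\<close>

lemma coeff_lincomb:
  assumes "\<And>K. K \<in> A \<Longrightarrow> coeff (f K) S w = (\<Sum>u\<in>W. g K u * v u)"
  shows "coeff (\<Sum>K\<in>A. scaleQ (d K) (f K)) S w = (\<Sum>u\<in>W. (\<Sum>K\<in>A. d K * g K u) * v u)"
proof -
  have "coeff (\<Sum>K\<in>A. scaleQ (d K) (f K)) S w = (\<Sum>K\<in>A. \<Sum>u\<in>W. d K * g K u * v u)"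
    unfolding coeff_sum_scaleQ
    by (intro sum.cong refl) (simp add: assms sum_distrib_left mult.assoc)
  then show ?thesis by (simp add: sum.swap[of _ A] sum_distrib_right)
qed

section \<open>The three expansions\<close>

text \<open>For a word of type \<open>T\<close> the weights on the right add up to the sum of
  \<open>moebius n m I K\<close> over the interval from \<open>I\<close> to \<open>T\<close>, which
  is 1 if \<open>T = I\<close> and 0 otherwise.\<close>

lemma m_fun_eq_sum_p_fun:
  assumes I: "I \<in> supercomps n m"
  shows "m_fun n m I =
    (\<Sum>K\<in>{K \<in> supercomps n m. sc_le m I K}. scaleQ (of_int (moebius n m I K)) (p_fun n m K))"
proof (rule sseries_eqI)
  fix S w
  let ?W = "monomial_words n m S w"
  have "(\<Sum>K\<in>{K \<in> supercomps n m. sc_le m I K}.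
      of_int (moebius n m I K) * (if sc_le m K (word_type n m u) then 1 else 0)) =
      (if word_type n m u = I then 1 else 0 :: rat)" if u: "u \<in> ?W" for u
  proof -
    have "(\<Sum>K\<in>{K \<in> supercomps n m. sc_le m I K}.
        of_int (moebius n m I K) * (if sc_le m K (word_type n m u) then 1 else 0)) =
      (\<Sum>K\<in>{K \<in> supercomps n m. sc_le m I K \<and> sc_le m K (word_type n m u)}.
        of_int (moebius n m I K) :: rat)"
      by (rule sum.mono_neutral_cong_right) (auto simp: finite_supercomps)
    also have "\<dots> = of_int (if I = word_type n m u then 1 else 0)"
      unfolding of_int_sum[symmetric] sum_moebius_right[OF I monomial_words_type[OF u]] ..
    finally show ?thesis by simp
  qed
  then show "coeff (m_fun n m I) S w = coeff (\<Sum>K\<in>{K \<in> supercomps n m. sc_le m I K}.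
      scaleQ (of_int (moebius n m I K)) (p_fun n m K)) S w"
    by (subst coeff_lincomb[OF coeff_p_fun]) (auto simp: coeff_m_fun[OF I] intro!: sum.cong)
qed

text \<open>The common argument for \<open>e_fun\<close> and \<open>h_fun\<close>. If a weight is
  the down-set sum of \<open>F\<close> at the meet of \<open>K\<close> with the type, then inversion
  in \<open>K\<close> turns it into \<open>F L\<close> times the weight in \<open>p_fun\<close> at
  \<open>L\<close>. The predicate \<open>P\<close> admits words missing from a family, provided that
  their types do not lie above \<open>L\<close>.\<close>

lemma scaleQ_p_fun_eq_sum:
  fixes F :: "nat set list \<Rightarrow> rat"
  assumes L: "L \<in> supercomps n m"
    and f: "\<And>K. K \<in> supercomps n m \<Longrightarrow>
      coeff (f K) S w = (\<Sum>u\<in>monomial_words n m S w. g K u * coeff (word_val u) S w)"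
    and g: "\<And>K u. K \<in> supercomps n m \<Longrightarrow> u \<in> monomial_words n m S w \<Longrightarrow>
      g K u = (if P u then
        \<Sum>N\<in>{N \<in> supercomps n m. sc_le m N (sc_meet n m K (word_type n m u))}. F N else 0)"
    and P: "\<And>u. u \<in> monomial_words n m S w \<Longrightarrow> sc_le m L (word_type n m u) \<Longrightarrow> P u"
  shows "coeff (\<Sum>K\<in>{K \<in> supercomps n m. sc_le m K L}. scaleQ (of_int (moebius n m K L)) (f K)) S w =
    coeff (scaleQ (F L) (p_fun n m L)) S w"
proof -
  have "(\<Sum>K\<in>{K \<in> supercomps n m. sc_le m K L}. of_int (moebius n m K L) * g K u) =
      F L * (if sc_le m L (word_type n m u) then 1 else 0)"
    if u: "u \<in> monomial_words n m S w" for u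
  proof (cases "P u")
    case True
    have "(\<Sum>K\<in>{K \<in> supercomps n m. sc_le m K L}. of_int (moebius n m K L) * g K u) =
      (\<Sum>K\<in>{K \<in> supercomps n m. sc_le m K L}. of_int (moebius n m K L) *
        (\<Sum>N\<in>{N \<in> supercomps n m. sc_le m N (word_type n m u) \<and> sc_le m N K}. F N))"
    proof (rule sum.cong[OF refl])
      fix K assume "K \<in> {K \<in> supercomps n m. sc_le m K L}"
      then have K: "K \<in> supercomps n m" by simp
      have "{N \<in> supercomps n m. sc_le m N (sc_meet n m K (word_type n m u))} =
          {N \<in> supercomps n m. sc_le m N (word_type n m u) \<and> sc_le m N K}"
        using sc_le_meet_iff[OF K monomial_words_type[OF u]] by blast
      then show "of_int (moebius n m K L) * g K u = of_int (moebius n m K L) *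
        (\<Sum>N\<in>{N \<in> supercomps n m. sc_le m N (word_type n m u) \<and> sc_le m N K}. F N)"
        using g[OF K u] True by simp
    qed
    also have "\<dots> = F L * (if sc_le m L (word_type n m u) then 1 else 0)"
      unfolding sum_moebius_down_sum[OF L] by simp
    finally show ?thesis .
  next
    case False
    then have "\<not> sc_le m L (word_type n m u)" using P[OF u] by blast
    then show ?thesis using g[OF _ u] False by simp
  qed
  then show ?thesis
    by (subst coeff_lincomb[OF f], simp)
       (simp add: scaleQ.rep_eq coeff_p_fun[OF L] sum_distrib_left mult.assoc)
qed

text \<open>Here \<open>F\<close> is the Moebius function from the least element. Its down-set sum
  is 1 at the least element and 0 elsewhere, which is the weight in \<open>e_fun\<close>.\<close>

lemma sum_e_fun:
  assumes L: "L \<in> supercomps n m"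
  shows "(\<Sum>K\<in>{K \<in> supercomps n m. sc_le m K L}. scaleQ (of_int (moebius n m K L)) (e_fun n m K)) =
    scaleQ (of_int (moebius n m (sc_bot n m) L)) (p_fun n m L)"
proof (rule sseries_eqI, rule scaleQ_p_fun_eq_sum[where P = "\<lambda>_. True", OF L coeff_e_fun], assumption)
  fix S w K u assume K: "K \<in> supercomps n m" and u: "u \<in> monomial_words n m S w"
  let ?N = "sc_meet n m K (word_type n m u)"
  have N: "?N \<in> supercomps n m" using sc_meet_linked(1)[OF K monomial_words_type[OF u]] .
  have "{N \<in> supercomps n m. sc_le m N ?N} =
      {N \<in> supercomps n m. sc_le m (sc_bot n m) N \<and> sc_le m N ?N}"
    using sc_bot_le by blast
  then have "(\<Sum>N\<in>{N \<in> supercomps n m. sc_le m N ?N}. of_int (moebius n m (sc_bot n m) N)) =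
      (of_int (if sc_bot n m = ?N then 1 else 0) :: rat)"
    by (simp only: of_int_sum[symmetric] sum_moebius_right[OF sc_bot_supercomps N])
  then show "(if ?N = sc_bot n m then 1 else 0) = (if True then
      \<Sum>N\<in>{N \<in> supercomps n m. sc_le m N ?N}. of_int (moebius n m (sc_bot n m) N) else 0 :: rat)"
    by auto
qed simp

text \<open>Here \<open>F\<close> is the cycle weight at 1, whose down-set sum is the block
  factorial. By \<open>one\<close>, the words left out of \<open>h_fun\<close> have no type above
  \<open>L\<close>.\<close>

lemma sum_h_fun:
  assumes L: "L \<in> supercomps n m"
    and one: "\<And>i j. i < j \<Longrightarrow> j < m \<Longrightarrow> L ! i \<noteq> {0} \<or> L ! j \<noteq> {0}"
  shows "(\<Sum>K\<in>{K \<in> supercomps n m. sc_le m K L}. scaleQ (of_int (moebius n m K L)) (h_fun n m K)) =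
    scaleQ (of_int \<bar>moebius n m (sc_bot n m) L\<bar>) (p_fun n m L)"
  unfolding abs_moebius_sc_bot[OF L]
proof (rule sseries_eqI, rule scaleQ_p_fun_eq_sum[OF L coeff_h_fun])
  fix S w K u assume K: "K \<in> supercomps n m" and u: "u \<in> monomial_words n m S w"
  show "(if card (set (fst u) - set (snd u)) \<le> 1
     then of_nat (sc_fact (sc_meet n m K (word_type n m u))) else 0) =
    (if card (set (fst u) - set (snd u)) \<le> 1 then
      \<Sum>N\<in>{N \<in> supercomps n m. sc_le m N (sc_meet n m K (word_type n m u))}. cycle_weight m 1 N else 0)"
    using sum_cycle_weight_1[OF sc_meet_linked(1)[OF K monomial_words_type[OF u]]] by simp
next
  fix S w u assume "u \<in> monomial_words n m S w" "sc_le m L (word_type n m u)"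
  then show "card (set (fst u) - set (snd u)) \<le> 1"
    using h_condition[OF L _ _ _ one] by (auto simp: monomial_words_def)
qed

text \<open>A fermionic block of \<open>I\<close> is nonempty and contained in the block of
  \<open>L\<close> with the same index, so a block \<open>{0}\<close> of \<open>L\<close> is already
  \<open>{0}\<close> in \<open>I\<close>, whose blocks are pairwise different.\<close>

lemma superpartition_above_zero_blocks:
  assumes I: "I \<in> superpartitions n m" and le: "sc_le m I L" and ij: "i < j" "j < m"
  shows "L ! i \<noteq> {0} \<or> L ! j \<noteq> {0}"
proof (rule ccontr)
  assume *: "\<not> (L ! i \<noteq> {0} \<or> L ! j \<noteq> {0})"
  have sc: "I \<in> supercomps n m" using I by (simp add: superpartitions_def)
  have len: "m \<le> length I" using supercomps_length[OF sc] .
  have "I ! k = {0}" if "k < m" "L ! k = {0}" for k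
  proof -
    have "I ! k \<subseteq> L ! k" using le that(1) unfolding sc_le_def by blast
    moreover have "I ! k \<noteq> {}" using supercomps_nth[OF sc, of k] that len by simp
    ultimately show ?thesis using that by auto
  qed
  then have "I ! i = I ! j" using * ij by simp
  moreover have "I ! i \<noteq> I ! j" using I ij len by (simp add: superpartitions_def)
  ultimately show False by simp
qed

lemma scaleQ_scaleQ: "scaleQ c (scaleQ d f) = scaleQ (c * d) f"
  by (rule sseries_eqI) (simp add: scaleQ.rep_eq)

theorem proposition4p11:
  fixes n m :: nat and I :: "nat set list"
  assumes "m \<le> n + 1" and "I \<in> superpartitions n m"
  shows "(m_fun n m I =
      (\<Sum>K\<in>{K \<in> supercomps n m. sc_le m I K}. scaleQ (of_int (moebius n m I K)) (p_fun n m K))) \<and>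
    (m_fun n m I =
      (\<Sum>L\<in>{L \<in> supercomps n m. sc_le m I L}.
         scaleQ (of_int (moebius n m I L) / of_int (moebius n m (sc_bot n m) L))
           (\<Sum>K\<in>{K \<in> supercomps n m. sc_le m K L}. scaleQ (of_int (moebius n m K L)) (e_fun n m K)))) \<and>
    (m_fun n m I =
      (\<Sum>L\<in>{L \<in> supercomps n m. sc_le m I L}.
         scaleQ (of_int (moebius n m I L) / of_int \<bar>moebius n m (sc_bot n m) L\<bar>)
           (\<Sum>K\<in>{K \<in> supercomps n m. sc_le m K L}. scaleQ (of_int (moebius n m K L)) (h_fun n m K))))"
proof -
  have I: "I \<in> supercomps n m" using assms(2) by (simp add: superpartitions_def)
  note p = m_fun_eq_sum_p_fun[OF I]
  \<comment> \<open>The other two expansions reduce to the first term by term: the inner sum is a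
    multiple of \<open>p_fun\<close> at \<open>L\<close>, and the denominator cancels the
    factor.\<close>
  have e: "scaleQ (of_int (moebius n m I L) / of_int (moebius n m (sc_bot n m) L))
      (\<Sum>K\<in>{K \<in> supercomps n m. sc_le m K L}. scaleQ (of_int (moebius n m K L)) (e_fun n m K)) =
      scaleQ (of_int (moebius n m I L)) (p_fun n m L)"
    if "L \<in> {L \<in> supercomps n m. sc_le m I L}" for L
    using that moebius_sc_bot_nonzero[of L n m] by (simp add: sum_e_fun scaleQ_scaleQ)
  have h: "scaleQ (of_int (moebius n m I L) / of_int \<bar>moebius n m (sc_bot n m) L\<bar>)
      (\<Sum>K\<in>{K \<in> supercomps n m. sc_le m K L}. scaleQ (of_int (moebius n m K L)) (h_fun n m K)) =
      scaleQ (of_int (moebius n m I L)) (p_fun n m L)"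
    if "L \<in> {L \<in> supercomps n m. sc_le m I L}" for L
    using that moebius_sc_bot_nonzero[of L n m] superpartition_above_zero_blocks[OF assms(2), of L]
    by (simp add: sum_h_fun scaleQ_scaleQ)
  show ?thesis
    unfolding p by (intro conjI refl sum.cong[OF refl e, symmetric] sum.cong[OF refl h, symmetric])
qed

end
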